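(* Let $G=(V,E)$ be a minimally $d$-rigid graph with at least $d+1$ vertices and let $G'$ be obtained from $G$ by a $d$-dimensional spider-split. Then $r_d(G')\ge r_d(G)$.
   Context: A $d$-dimensional spider-split takes a graph $G$, a vertex $x$, and a partition of the neighbourhood of $x$ into sets $N_1$, $N_2$ and $\{w_1,\dots,w_d\}$; it outputs the graph obtained from $G-x$ by adding new vertices $x_1,x_2$, with $x_i$ joined to all of $N_i$ ($i=1,2$) and both joined to each of $w_1,\dots,w_d$ (no edge $x_1x_2$). On $\mathbb{R}^d$, $\|\cdot\|$ is the Euclidean norm. A realisation $p:V\to\mathbb{R}^d$ is generic if its coordinates are algebraically independent over $\mathbb{Q}$; realisations are equivalent if all edge lengths agree, congruent if related by an isometry. $G$ is $d$-rigid if some generic framework is rigid, minimally $d$-rigid if moreover $G-e$ is not $d$-rigid for all edges $e$. $r_d(G)$ is the maximum over generic $p:V\to\mathbb{R}^d$ of the number of congruence classes of real realisations equivalent to $p$. *)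

theory Defs
  imports "HOL-Analysis.Analysis" "HOL-Library.Extended_Nat" "HOL-Library.FuncSet"
begin

definition simple_graph :: "'a set \<Rightarrow> 'a set set \<Rightarrow> bool" where
  "simple_graph V E \<longleftrightarrow> finite V \<and> (\<forall>e\<in>E. \<exists>u v. u \<in> V \<and> v \<in> V \<and> u \<noteq> v \<and> e = {u, v})"

definition nbhd :: "'a set set \<Rightarrow> 'a \<Rightarrow> 'a set" where
  "nbhd E x = {v. {x, v} \<in> E}"

definition spider_split ::
  "nat \<Rightarrow> 'a set \<Rightarrow> 'a set set \<Rightarrow> 'a \<Rightarrow> 'a set \<Rightarrow> 'a set \<Rightarrow> 'a set \<Rightarrow> 'a \<Rightarrow> 'a
     \<Rightarrow> 'a set \<Rightarrow> 'a set set \<Rightarrow> bool" where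
  "spider_split d V E x N1 N2 W x1 x2 V' E' \<longleftrightarrow>
     x \<in> V \<and> N1 \<inter> N2 = {} \<and> N1 \<inter> W = {} \<and> N2 \<inter> W = {} \<and>
     N1 \<union> N2 \<union> W = nbhd E x \<and> finite W \<and> card W = d \<and>
     x1 \<noteq> x2 \<and> x1 \<notin> V - {x} \<and> x2 \<notin> V - {x} \<and>
     V' = (V - {x}) \<union> {x1, x2} \<and>
     E' = {e \<in> E. x \<notin> e} \<union> {{x1, v} | v. v \<in> N1 \<union> W} \<union> {{x2, v} | v. v \<in> N2 \<union> W}"

definition alg_indep_Q :: "'i set \<Rightarrow> ('i \<Rightarrow> real) \<Rightarrow> bool" where
  "alg_indep_Q I y \<longleftrightarrow>
     (\<forall>c :: ('i \<Rightarrow> nat) \<Rightarrow> rat.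
        finite {m. c m \<noteq> 0} \<and> (\<forall>m. c m \<noteq> 0 \<longrightarrow> (\<forall>i. i \<notin> I \<longrightarrow> m i = 0)) \<and>
        (\<Sum>m\<in>{m. c m \<noteq> 0}. of_rat (c m) * (\<Prod>i\<in>I. y i ^ m i)) = 0
        \<longrightarrow> (\<forall>m. c m = 0))"

text \<open>Realisations in R^d are functions V \<rightarrow> real^'n, d = CARD('n).\<close>
definition generic :: "'a set \<Rightarrow> ('a \<Rightarrow> real^'n) \<Rightarrow> bool" where
  "generic V p \<longleftrightarrow> alg_indep_Q (V \<times> UNIV) (\<lambda>(v, i). p v $ i)"

definition equivalent_real :: "'a set set \<Rightarrow> ('a \<Rightarrow> real^'n) \<Rightarrow> ('a \<Rightarrow> real^'n) \<Rightarrow> bool" where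
  "equivalent_real E p q \<longleftrightarrow> (\<forall>u v. {u, v} \<in> E \<longrightarrow> dist (p u) (p v) = dist (q u) (q v))"

definition congruent_real :: "'a set \<Rightarrow> ('a \<Rightarrow> real^'n) \<Rightarrow> ('a \<Rightarrow> real^'n) \<Rightarrow> bool" where
  "congruent_real V p q \<longleftrightarrow>
     (\<exists>f :: real^'n \<Rightarrow> real^'n. (\<forall>a b. dist (f a) (f b) = dist a b) \<and> (\<forall>v\<in>V. q v = f (p v)))"

definition rigid_framework :: "'a set \<Rightarrow> 'a set set \<Rightarrow> ('a \<Rightarrow> real^'n) \<Rightarrow> bool" where
  "rigid_framework V E p \<longleftrightarrow>
     (\<exists>\<epsilon>>0. \<forall>q. (\<forall>v\<in>V. dist (q v) (p v) < \<epsilon>) \<and> equivalent_real E p q \<longrightarrow> congruent_real V p q)"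

definition d_rigid :: "'n::finite itself \<Rightarrow> 'a set \<Rightarrow> 'a set set \<Rightarrow> bool" where
  "d_rigid T V E \<longleftrightarrow> (\<exists>p :: 'a \<Rightarrow> real^'n. generic V p \<and> rigid_framework V E p)"

definition min_d_rigid :: "'n::finite itself \<Rightarrow> 'a set \<Rightarrow> 'a set set \<Rightarrow> bool" where
  "min_d_rigid T V E \<longleftrightarrow> d_rigid T V E \<and> (\<forall>e\<in>E. \<not> d_rigid T V (E - {e}))"

definition num_classes :: "'a set \<Rightarrow> 'a set set \<Rightarrow> ('a \<Rightarrow> real^'n) \<Rightarrow> enat" where
  "num_classes V E p =
     (let R = {q \<in> V \<rightarrow>\<^sub>E UNIV. equivalent_real E p q};
          C = R // {(q, q'). q \<in> R \<and> q' \<in> R \<and> congruent_real V q q'}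
      in if finite C then enat (card C) else \<infinity>)"

definition r_d :: "'n::finite itself \<Rightarrow> 'a set \<Rightarrow> 'a set set \<Rightarrow> enat" where
  "r_d T V E = (SUP p \<in> {p :: 'a \<Rightarrow> real^'n. p \<in> V \<rightarrow>\<^sub>E UNIV \<and> generic V p}. num_classes V E p)"

end

theory Submission
  imports Defs "HOL-Library.Function_Algebras"
begin

text \<open>Place both new vertices \<open>x1\<close>, \<open>x2\<close> at the position of \<open>x\<close>. Every framework equivalent to a generic
  framework of \<open>G\<close> then yields a framework of \<open>G'\<close>, and these are all equivalent and pairwise
  incongruent. If the edge length map of \<open>G'\<close> is a submersion at each of them, then they persist when
  the degenerate framework is perturbed to a generic one.

  The submersion property follows from two facts about every framework \<open>q\<close> equivalent to a generic
  \<open>p\<close>: the length map of \<open>G\<close> is a submersion at \<open>q\<close>, and the vectors \<open>q w - q x\<close> with \<open>w \<in> W\<close> form a basis.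
  Both are obtained from derivations \<open>D : \<real> \<rightarrow> \<real>\<close>. The edge lengths of \<open>p\<close> are algebraically independent,
  so derivations take arbitrary values on them; as \<open>q\<close> has the same lengths, applying such a
  derivation to the coordinates of \<open>q\<close> gives a preimage under the differential of the length map
  at \<open>q\<close>. For the second fact, rigidity makes the number of edges equal to the number of coordinates
  left after removing isometries, so that no such coordinate can degenerate at \<open>q\<close>.\<close>

section \<open>Derivations of the real numbers\<close>

text \<open>A framework \<open>q\<close> equivalent to a generic \<open>p\<close> need not be
  generic. A priori it could put \<open>W\<close> into a hyperplane through \<open>q x\<close>, and
  a linear relation between the vectors \<open>q w - q x\<close> would then be one between the rows
  of the edges \<open>x1 w\<close> and \<open>x2 w\<close> in the split framework. All that
  \<open>q\<close> inherits from \<open>p\<close> is a list of real numbers, its squared edge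
  lengths, so whatever is needed at \<open>q\<close> has to be extracted from these numbers.
  Derivations allow this: they turn polynomial relations between reals into linear ones, and they
  extend from any subring to all of \<real>, so arguments on transcendence degree become linear
  algebra over \<real>. Perturbation needs radii common to all frameworks treated, hence the bound
  is shown for each finite number of classes, which also covers an infinite count.\<close>

inductive_set ring_hull :: "'b::comm_ring_1 set \<Rightarrow> 'b set" for S where
  one: "1 \<in> ring_hull S"
| gen: "a \<in> S \<Longrightarrow> a \<in> ring_hull S"
| diff: "\<lbrakk>a \<in> ring_hull S; b \<in> ring_hull S\<rbrakk> \<Longrightarrow> a - b \<in> ring_hull S"
| mult: "\<lbrakk>a \<in> ring_hull S; b \<in> ring_hull S\<rbrakk> \<Longrightarrow> a * b \<in> ring_hull S"

lemma ring_hull_zero: "0 \<in> ring_hull S"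
  using ring_hull.diff[OF ring_hull.one ring_hull.one] by simp

lemma ring_hull_minus: "a \<in> ring_hull S \<Longrightarrow> - a \<in> ring_hull S"
  using ring_hull.diff[OF ring_hull_zero, of a S] by simp

lemma ring_hull_add: "\<lbrakk>a \<in> ring_hull S; b \<in> ring_hull S\<rbrakk> \<Longrightarrow> a + b \<in> ring_hull S"
  using ring_hull.diff[of a S "- b"] ring_hull_minus[of b S] by simp

lemma ring_hull_sum: "(\<And>i. i \<in> I \<Longrightarrow> f i \<in> ring_hull S) \<Longrightarrow> sum f I \<in> ring_hull S"
  by (induction I rule: infinite_finite_induct) (auto intro: ring_hull_zero ring_hull_add)

lemma ring_hull_power: "a \<in> ring_hull S \<Longrightarrow> a ^ k \<in> ring_hull S"
  by (induction k) (auto intro: ring_hull.intros)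

lemma ring_hull_prod: "(\<And>i. i \<in> I \<Longrightarrow> f i \<in> ring_hull S) \<Longrightarrow> prod f I \<in> ring_hull S"
  by (induction I rule: infinite_finite_induct) (auto intro: ring_hull.intros)

lemma ring_hull_of_nat: "of_nat k \<in> ring_hull S"
  by (induction k) (auto intro: ring_hull_zero ring_hull_add ring_hull.one)

lemma ring_hull_subset: "S \<subseteq> ring_hull T \<Longrightarrow> ring_hull S \<subseteq> ring_hull T"
proof
  fix a assume "S \<subseteq> ring_hull T" "a \<in> ring_hull S"
  from this(2,1) show "a \<in> ring_hull T"
    by induction (auto intro: ring_hull.intros)
qed

lemma ring_hull_image:
  assumes "f 1 = 1" "\<And>a b. f (a - b) = f a - f b" "\<And>a b. f (a * b) = f a * f b"
  shows "ring_hull (f ` S) = f ` ring_hull S"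
proof
  show "ring_hull (f ` S) \<subseteq> f ` ring_hull S"
  proof
    fix b assume "b \<in> ring_hull (f ` S)"
    then show "b \<in> f ` ring_hull S"
    proof induction
      case one
      then show ?case by (metis assms(1) imageI ring_hull.one)
    next
      case (gen a)
      then show ?case by (auto intro: ring_hull.gen)
    next
      case (diff a b)
      then show ?case by (auto simp: assms(2)[symmetric] intro: ring_hull.diff)
    next
      case (mult a b)
      then show ?case by (auto simp: assms(3)[symmetric] intro: ring_hull.mult)
    qed
  qed
  show "f ` ring_hull S \<subseteq> ring_hull (f ` S)"
  proof clarify
    fix a assume "a \<in> ring_hull S"
    then show "f a \<in> ring_hull (f ` S)"
      by induction (auto simp: assms intro: ring_hull.intros)
  qed
qed

text \<open>Evaluation at \<open>y\<close> is a ring homomorphism. This links the two uses of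
  \<open>ring_hull\<close>: among functions it gives the integer polynomials in the generators,
  among reals the values of these polynomials.\<close>

lemma ring_hull_eval:
  fixes S :: "('b \<Rightarrow> 'c::comm_ring_1) set"
  shows "ring_hull ((\<lambda>f. f y) ` S) = (\<lambda>f. f y) ` ring_hull S"
  by (rule ring_hull_image) (auto simp: one_fun_def)

section \<open>Algebraic elements over a subring\<close>

text \<open>In the uses \<open>A\<close> is a subring rather than a field and \<open>P\<close> need
  not be monic; by clearing denominators this is the same notion as over the fraction field, without
  division.\<close>

definition algebraic_over :: "real set \<Rightarrow> real \<Rightarrow> bool" where
  "algebraic_over A a \<longleftrightarrow> (\<exists>P. P \<noteq> 0 \<and> (\<forall>k. coeff P k \<in> A) \<and> poly P a = 0)"

text \<open>In characteristic 0 the derivative of a polynomial of least degree is nonzero, of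
  smaller degree and still has coefficients in \<open>A\<close>, so it cannot vanish at
  \<open>a\<close>: the root is simple. \<open>M\<close> replaces the minimal polynomial.\<close>

lemma algebraic_over_least_degree:
  assumes "algebraic_over A a"
    and "\<And>k b. b \<in> A \<Longrightarrow> of_nat k * b \<in> A"
  obtains M where "M \<noteq> 0" "\<And>k. coeff M k \<in> A" "poly M a = 0" "poly (pderiv M) a \<noteq> 0"
    "\<And>P. (\<And>k. coeff P k \<in> A) \<Longrightarrow> poly P a = 0 \<Longrightarrow> degree P < degree M \<Longrightarrow> P = 0"
proof -
  define X where "X P \<longleftrightarrow> P \<noteq> 0 \<and> (\<forall>k. coeff P k \<in> A) \<and> poly P a = 0" for P
  define M where "M = arg_min degree X"
  have "\<exists>P. X P" using assms(1) by (auto simp: algebraic_over_def X_def)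
  then have M: "X M" and least: "\<And>P. X P \<Longrightarrow> degree M \<le> degree P"
    unfolding M_def by (metis arg_min_nat_lemma)+
  have deg: "degree M \<noteq> 0"
  proof
    assume "degree M = 0"
    then obtain c where "M = [:c:]" by (rule degree_eq_zeroE)
    then show False using M by (auto simp: X_def)
  qed
  have "\<not> X (pderiv M)"
    using least[of "pderiv M"] deg by (auto simp: degree_pderiv)
  moreover have "coeff (pderiv M) k \<in> A" for k
    using M assms(2)[of "coeff M (Suc k)" "Suc k"] by (simp add: X_def coeff_pderiv)
  ultimately have "poly (pderiv M) a \<noteq> 0"
    using deg by (auto simp: X_def pderiv_eq_0_iff)
  moreover have "P = 0" if "\<And>k. coeff P k \<in> A" "poly P a = 0" "degree P < degree M" for P
    using least[of P] that by (auto simp: X_def)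
  ultimately show thesis
    using that[of M] M by (auto simp: X_def)
qed

section \<open>Extension of derivations from subrings\<close>

definition derivation :: "(real \<Rightarrow> real) \<Rightarrow> bool" where
  "derivation D \<longleftrightarrow> (\<forall>a b. D (a + b) = D a + D b) \<and> (\<forall>a b. D (a * b) = a * D b + D a * b)"

text \<open>The graph of a derivation on a subring of \<open>\<real>\<close> with values in \<open>\<real>\<close>,
  that is, a subring of the dual numbers on which the first projection is injective.\<close>

definition partial_derivation :: "(real \<times> real) set \<Rightarrow> bool" where
  "partial_derivation G \<longleftrightarrow> (1, 0) \<in> G \<and>
     (\<forall>a a' b b'. (a, a') \<in> G \<longrightarrow> (b, b') \<in> G \<longrightarrow> (a - b, a' - b') \<in> G \<and> (a * b, a * b' + a' * b) \<in> G) \<and>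
     (\<forall>c. (0, c) \<in> G \<longrightarrow> c = 0)"

context
  fixes G assumes G: "partial_derivation G"
begin

lemma pder_one: "(1, 0) \<in> G"
  and pder_diff: "(b, b') \<in> G \<Longrightarrow> (c, c') \<in> G \<Longrightarrow> (b - c, b' - c') \<in> G"
  and pder_mult: "(b, b') \<in> G \<Longrightarrow> (c, c') \<in> G \<Longrightarrow> (b * c, b * c' + b' * c) \<in> G"
  and pder_inj: "(0, c) \<in> G \<Longrightarrow> c = 0"
  using G by (auto simp: partial_derivation_def)

lemma pder_zero: "(0, 0) \<in> G"
  using pder_diff[OF pder_one pder_one] by simp

lemma pder_add: "(b, b') \<in> G \<Longrightarrow> (c, c') \<in> G \<Longrightarrow> (b + c, b' + c') \<in> G"
  using pder_diff[of b b' "- c" "- c'"] pder_diff[OF pder_zero, of c c'] by simp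

lemma pder_sum: "(\<And>i. i \<in> I \<Longrightarrow> (f i, g i) \<in> G) \<Longrightarrow> (sum f I, sum g I) \<in> G"
  by (induction I rule: infinite_finite_induct) (auto intro: pder_zero pder_add)

text \<open>A polynomial over the dual numbers, split into components: \<open>Q\<close> is
  \<open>P\<close> with the partial derivation applied to each coefficient.\<close>

definition pder_poly :: "real poly \<Rightarrow> real poly \<Rightarrow> bool" where
  "pder_poly P Q \<longleftrightarrow> (\<forall>k. (coeff P k, coeff Q k) \<in> G)"

lemma pder_poly_diff:
  "pder_poly P Q \<Longrightarrow> pder_poly P' Q' \<Longrightarrow> pder_poly (P - P') (Q - Q')"
  by (auto simp: pder_poly_def pder_diff)

lemma pder_poly_mult:
  "pder_poly P Q \<Longrightarrow> pder_poly P' Q' \<Longrightarrow> pder_poly (P * P') (P * Q' + Q * P')"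
  unfolding pder_poly_def coeff_add coeff_mult sum.distrib[symmetric]
  by (auto intro!: pder_sum pder_mult)

lemma pder_poly_monom: "(b, b') \<in> G \<Longrightarrow> pder_poly (monom b k) (monom b' k)"
  by (auto simp: pder_poly_def pder_zero)

lemma pder_poly_zero: "pder_poly 0 Q \<Longrightarrow> Q = 0"
  by (auto simp: pder_poly_def poly_eq_iff intro: pder_inj)

text \<open>Once \<open>D a = c\<close>, the chain rule forces
  \<open>D (poly P a) = poly Q a + poly (pderiv P) a * c\<close>; the condition says that this
  prescription respects the relations satisfied by \<open>a\<close>.\<close>

definition compatible_value :: "real \<Rightarrow> real \<Rightarrow> bool" where
  "compatible_value a c \<longleftrightarrow>
     (\<forall>P Q. pder_poly P Q \<longrightarrow> poly P a = 0 \<longrightarrow> poly Q a + poly (pderiv P) a * c = 0)"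

lemma compatible_value_transcendental:
  assumes "\<not> algebraic_over (fst ` G) a"
  shows "compatible_value a c"
  unfolding compatible_value_def
proof (intro allI impI)
  fix P Q assume PQ: "pder_poly P Q" "poly P a = 0"
  then have "\<forall>k. coeff P k \<in> fst ` G"
    by (force simp: pder_poly_def)
  with PQ assms have "P = 0"
    by (auto simp: algebraic_over_def)
  moreover from this have "Q = 0"
    using PQ pder_poly_zero by blast
  ultimately show "poly Q a + poly (pderiv P) a * c = 0"
    by simp
qed

text \<open>The simple root of a least-degree \<open>M\<close> determines \<open>c\<close> through
  the equation for \<open>M\<close> itself. Every other annihilating \<open>P\<close> follows by
  lowering its degree modulo \<open>M\<close>.\<close>

lemma compatible_value_algebraic:
  assumes "algebraic_over (fst ` G) a"
  shows "\<exists>c. compatible_value a c"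
proof -
  have "of_nat k * b \<in> fst ` G" if b: "b \<in> fst ` G" for k b
  proof -
    obtain b' where b': "(b, b') \<in> G" using b by auto
    have "(of_nat k * b, of_nat k * b') \<in> G"
      by (induction k) (auto intro: pder_zero pder_add b' simp: ring_distribs)
    then show ?thesis by force
  qed
  from algebraic_over_least_degree[OF assms this]
  obtain M where M: "M \<noteq> 0" "\<And>k. coeff M k \<in> fst ` G" "poly M a = 0" "poly (pderiv M) a \<noteq> 0"
    and least: "\<And>P. (\<And>k. coeff P k \<in> fst ` G) \<Longrightarrow> poly P a = 0 \<Longrightarrow> degree P < degree M \<Longrightarrow> P = 0"
    by blast
  have "\<forall>k. \<exists>n. (coeff M k, n) \<in> G"
    using M(2) by force
  then obtain n where n: "\<And>k. (coeff M k, n k) \<in> G"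
    by metis
  have n0: "n k = 0" if "k > degree M" for k
    using n[of k] that pder_inj by (simp add: coeff_eq_0)
  define N where "N = (\<Sum>k\<le>degree M. monom (n k) k)"
  have "coeff N k = n k" for k
    using n0[of k] unfolding N_def coeff_sum by (simp add: not_le)
  then have MN: "pder_poly M N"
    using n by (simp add: pder_poly_def)
  define c where "c = - poly N a / poly (pderiv M) a"
  have c: "poly N a + poly (pderiv M) a * c = 0"
    using M(4) by (simp add: c_def)
  have "poly Q a + poly (pderiv P) a * c = 0" if "pder_poly P Q" "poly P a = 0" for P Q
    using that
  proof (induction "degree P" arbitrary: P Q rule: less_induct)
    case less
    have coeffs: "\<forall>k. coeff P k \<in> fst ` G"
      using less.prems(1) by (force simp: pder_poly_def)
    show ?case
    proof (cases "degree P < degree M")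
      case True
      then have "P = 0" using coeffs less.prems(2) least by blast
      moreover from this have "Q = 0" using less.prems(1) pder_poly_zero by blast
      ultimately show ?thesis by simp
    next
      case False
      \<comment> \<open>One step of pseudo-division: multiplying by the leading coefficient
        \<open>l\<close>, instead of dividing by it, stays in the subring. \<open>Q'\<close> is the
        companion of \<open>P'\<close> under the product rule, and \<open>l \<noteq> 0\<close> leads
        back from \<open>P'\<close> to \<open>P\<close>.\<close>
      define k l l' b b' where "k = degree P - degree M" and "l = lead_coeff M"
        and "l' = n (degree M)" and "b = lead_coeff P" and "b' = coeff Q (degree P)"
      define P' Q' where "P' = monom l 0 * P - monom b k * M"
        and "Q' = (monom l 0 * Q + monom l' 0 * P) - (monom b k * N + monom b' k * M)"
      have "(l, l') \<in> G" "(b, b') \<in> G"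
        using n less.prems(1) by (auto simp: l_def l'_def b_def b'_def pder_poly_def)
      then have PQ': "pder_poly P' Q'"
        unfolding P'_def Q'_def
        by (intro pder_poly_diff pder_poly_mult pder_poly_monom less.prems MN)
      have root: "poly P' a = 0"
        using less.prems(2) M(3) by (simp add: P'_def)
      have val: "poly Q' a + poly (pderiv P') a * c
          = l * (poly Q a + poly (pderiv P) a * c) - b * a ^ k * (poly N a + poly (pderiv M) a * c)"
        using less.prems(2) M(3)
        by (simp add: P'_def Q'_def pderiv_diff pderiv_mult poly_monom pderiv_monom algebra_simps)
      have "l \<noteq> 0" using M(1) by (simp add: l_def)
      have "poly Q' a + poly (pderiv P') a * c = 0"
      proof (cases "P' = 0")
        case True
        moreover from this have "Q' = 0" using PQ' pder_poly_zero by blast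
        ultimately show ?thesis by simp
      next
        case P': False
        have "degree P' < degree P"
        proof (cases "degree P = 0")
          case True
          then have "degree M = 0" using False by simp
          then show ?thesis using M(1,3) by (auto elim!: degree_eq_zeroE)
        next
          case deg: False
          have "degree P' \<le> degree P"
            unfolding P'_def
          proof (rule degree_diff_le)
            show "degree (monom l 0 * P) \<le> degree P"
              using degree_mult_le[of "monom l 0" P] by (simp add: monom_0)
            have "degree (monom b k * M) \<le> degree (monom b k) + degree M"
              by (rule degree_mult_le)
            also have "\<dots> \<le> k + degree M" using degree_monom_le by (rule add_right_mono)
            finally show "degree (monom b k * M) \<le> degree P" using False by (simp add: k_def)
          qed
          moreover have "coeff P' (degree P) = 0"
            using False by (simp add: P'_def monom_0 coeff_monom_mult k_def l_def b_def)
          ultimately show ?thesis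
            using P' by (metis le_neq_implies_less leading_coeff_0_iff)
        qed
        then show ?thesis using less.hyps PQ' root by blast
      qed
      then show ?thesis using val c \<open>l \<noteq> 0\<close> by simp
    qed
  qed
  then show ?thesis unfolding compatible_value_def by blast
qed

text \<open>\<open>H\<close> is the subring of the dual numbers generated by \<open>G\<close> and
  \<open>(a, c)\<close>; compatibility of \<open>c\<close> says exactly that its first projection is
  still injective.\<close>

lemma partial_derivation_adjoin:
  assumes "compatible_value a c"
  shows "\<exists>H. partial_derivation H \<and> G \<subseteq> H \<and> (a, c) \<in> H"
proof -
  define H where "H = {(poly P a, poly Q a + poly (pderiv P) a * c) | P Q. pder_poly P Q}"
  have HI: "(b, b') \<in> H"
    if "pder_poly P Q" "b = poly P a" "b' = poly Q a + poly (pderiv P) a * c" for b b' P Q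
    using that by (auto simp: H_def)
  have "(a, c) \<in> H"
  proof (rule HI)
    show "pder_poly (monom 1 1) 0"
      using pder_poly_monom[OF pder_one, of 1] by simp
  qed (auto simp: poly_monom pderiv_monom)
  moreover have GH: "G \<subseteq> H"
  proof clarify
    fix b b' assume "(b, b') \<in> G"
    then show "(b, b') \<in> H"
      by (intro HI[OF pder_poly_monom[of b b' 0]]) (auto simp: poly_monom pderiv_monom)
  qed
  moreover have "partial_derivation H"
    unfolding partial_derivation_def
  proof (intro conjI allI impI)
    show "(1, 0) \<in> H" using GH pder_one by auto
  next
    fix d d' e e' assume "(d, d') \<in> H" "(e, e') \<in> H"
    then obtain P Q P' Q' where PQ: "pder_poly P Q" "pder_poly P' Q'"
      and eq: "d = poly P a" "d' = poly Q a + poly (pderiv P) a * c"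
        "e = poly P' a" "e' = poly Q' a + poly (pderiv P') a * c"
      by (auto simp: H_def)
    show "(d - e, d' - e') \<in> H"
      by (rule HI[OF pder_poly_diff[OF PQ]]) (auto simp: eq pderiv_diff algebra_simps)
    show "(d * e, d * e' + d' * e) \<in> H"
      by (rule HI[OF pder_poly_mult[OF PQ]]) (auto simp: eq pderiv_mult algebra_simps)
  next
    fix b assume "(0, b) \<in> H"
    then show "b = 0"
      using assms by (auto simp: H_def compatible_value_def)
  qed
  ultimately show ?thesis by blast
qed

end

text \<open>Zorn's lemma on graphs: a maximal one is total, because every real, algebraic or not,
  has a compatible value and could be adjoined.\<close>

lemma partial_derivation_extend:
  assumes "partial_derivation G"
  shows "\<exists>D. derivation D \<and> (\<forall>(a, c)\<in>G. D a = c)"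
proof -
  define X where "X = {H. partial_derivation H \<and> G \<subseteq> H}"
  have "\<exists>M\<in>X. \<forall>H\<in>X. M \<subseteq> H \<longrightarrow> H = M"
  proof (rule subset_Zorn)
    fix C assume C: "subset.chain X C"
    show "\<exists>U\<in>X. \<forall>H\<in>C. H \<subseteq> U"
    proof (cases "C = {}")
      case True
      then show ?thesis using assms by (auto simp: X_def)
    next
      case False
      have CX: "H \<in> C \<Longrightarrow> partial_derivation H \<and> G \<subseteq> H" for H
        using C by (auto simp: subset_chain_def X_def)
      have dir: "\<exists>H\<in>C. p \<in> H \<and> q \<in> H" if pq: "p \<in> \<Union>C" "q \<in> \<Union>C" for p q
      proof -
        obtain H H' where "H \<in> C" "H' \<in> C" "p \<in> H" "q \<in> H'" using pq by auto
        moreover from this have "H \<subseteq> H' \<or> H' \<subseteq> H"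
          using C by (auto simp: subset_chain_def)
        ultimately show ?thesis by blast
      qed
      have "partial_derivation (\<Union>C)"
        unfolding partial_derivation_def
      proof (intro conjI allI impI)
        show "(1, 0) \<in> \<Union>C" using False CX pder_one by blast
      next
        fix a a' b b' assume "(a, a') \<in> \<Union>C" "(b, b') \<in> \<Union>C"
        then obtain H where H: "H \<in> C" "(a, a') \<in> H" "(b, b') \<in> H" using dir by meson
        show "(a - b, a' - b') \<in> \<Union>C" using H CX pder_diff by blast
        show "(a * b, a * b' + a' * b) \<in> \<Union>C" using H CX pder_mult by blast
      next
        fix c assume "(0, c) \<in> \<Union>C"
        then show "c = 0" using CX pder_inj by blast
      qed
      moreover have "G \<subseteq> \<Union>C" using False CX by blast
      ultimately show ?thesis by (auto simp: X_def)
    qed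
  qed
  then obtain M where M: "partial_derivation M" "G \<subseteq> M"
    and max: "\<And>H. partial_derivation H \<Longrightarrow> M \<subseteq> H \<Longrightarrow> H = M"
    by (auto simp: X_def)
  have total: "\<exists>c. (a, c) \<in> M" for a
  proof -
    have "\<exists>c. compatible_value M a c"
      using compatible_value_algebraic[OF M(1)] compatible_value_transcendental[OF M(1)] by blast
    then show ?thesis
      using partial_derivation_adjoin[OF M(1)] max by metis
  qed
  have unique: "c = c'" if "(a, c) \<in> M" "(a, c') \<in> M" for a c c'
    using pder_inj[OF M(1), of "c - c'"] pder_diff[OF M(1) that] by simp
  define D where "D a = (THE c. (a, c) \<in> M)" for a
  have D: "(a, c) \<in> M \<longleftrightarrow> D a = c" for a c
    unfolding D_def using total unique by (metis theI)
  have "derivation D"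
    unfolding derivation_def
    using D pder_add[OF M(1)] pder_mult[OF M(1)] by metis
  with D M(2) show ?thesis by auto
qed

section \<open>Derivations and algebraic dependence\<close>

lemma derivation_add: "derivation D \<Longrightarrow> D (a + b) = D a + D b"
  and derivation_mult: "derivation D \<Longrightarrow> D (a * b) = a * D b + D a * b"
  by (auto simp: derivation_def)

lemma derivation_zero: "derivation D \<Longrightarrow> D 0 = 0"
  using derivation_add[of D 0 0] by simp

lemma derivation_one: "derivation D \<Longrightarrow> D 1 = 0"
  using derivation_mult[of D 1 1] by simp

lemma derivation_minus: "derivation D \<Longrightarrow> D (- a) = - D a"
  using derivation_add[of D a "- a"] by (simp add: derivation_zero)

lemma derivation_diff: "derivation D \<Longrightarrow> D (a - b) = D a - D b"
  using derivation_add[of D a "- b"] by (simp add: derivation_minus)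

lemma derivation_sum: "derivation D \<Longrightarrow> D (sum f I) = (\<Sum>i\<in>I. D (f i))"
  by (induction I rule: infinite_finite_induct) (auto simp: derivation_zero derivation_add)

lemma derivation_ring_hull:
  assumes "derivation D" "\<And>b. b \<in> S \<Longrightarrow> D b = 0" "a \<in> ring_hull S"
  shows "D a = 0"
  using assms(3)
  by induction (use assms(1,2) in \<open>auto simp: derivation_one derivation_diff derivation_mult\<close>)

lemma derivation_poly:
  assumes D: "derivation D" and "\<And>k. D (coeff P k) = 0"
  shows "D (poly P a) = poly (pderiv P) a * D a"
  using assms(2)
proof (induction P)
  case 0
  then show ?case using D by (simp add: derivation_zero)
next
  case (pCons b P)
  have "D b = 0" using pCons.prems[of 0] by simp
  moreover have "D (coeff P k) = 0" for k using pCons.prems[of "Suc k"] by simp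
  ultimately show ?case
    using D pCons.IH by (simp add: derivation_add derivation_mult pderiv_pCons algebra_simps)
qed

text \<open>Applying \<open>D\<close> to \<open>poly M a = 0\<close> gives
  \<open>poly (pderiv M) a * D a = 0\<close>, and the first factor is nonzero when \<open>M\<close>
  has least degree.\<close>

lemma derivation_algebraic:
  assumes D: "derivation D" "\<And>b. b \<in> S \<Longrightarrow> D b = 0" and "algebraic_over (ring_hull S) a"
  shows "D a = 0"
proof -
  obtain M where M: "\<And>k. coeff M k \<in> ring_hull S" "poly M a = 0" "poly (pderiv M) a \<noteq> 0"
    using algebraic_over_least_degree[OF assms(3)]
    by (metis ring_hull.mult ring_hull_of_nat)
  have "D (poly M a) = poly (pderiv M) a * D a"
    by (intro derivation_poly D derivation_ring_hull[of D S] M)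
  then show ?thesis using M D by (simp add: derivation_zero)
qed

text \<open>The zero derivation on the subring generated by \<open>S\<close> extends with any
  prescribed value at a transcendental element.\<close>

lemma transcendental_derivation:
  assumes "\<not> algebraic_over (ring_hull S) a"
  shows "\<exists>D. derivation D \<and> (\<forall>b\<in>S. D b = 0) \<and> D a = 1"
proof -
  define G where "G = ring_hull S \<times> {0::real}"
  have G: "partial_derivation G"
    by (auto simp: partial_derivation_def G_def intro: ring_hull.intros)
  have "fst ` G = ring_hull S" by (auto simp: G_def image_iff)
  then have "compatible_value G a 1"
    using compatible_value_transcendental[OF G] assms by simp
  then obtain H where "partial_derivation H" "G \<subseteq> H" "(a, 1) \<in> H"
    using partial_derivation_adjoin[OF G] by blast
  then obtain D where D: "derivation D" "\<forall>(b, c)\<in>H. D b = c"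
    using partial_derivation_extend by blast
  have "(b, 0) \<in> H" if "b \<in> S" for b
    using that \<open>G \<subseteq> H\<close> by (auto simp: G_def intro: ring_hull.gen)
  then have "D b = 0" if "b \<in> S" for b
    using that D(2) by fastforce
  then show ?thesis using D \<open>(a, 1) \<in> H\<close> by auto
qed

text \<open>For finite \<open>I\<close> this is algebraic independence over the rationals
  (\<open>free_familyI\<close>, \<open>free_family_transcendental\<close>), in a form that involves
  only the numbers \<open>a i\<close> and is open to linear algebra.\<close>

definition free_family :: "'i set \<Rightarrow> ('i \<Rightarrow> real) \<Rightarrow> bool" where
  "free_family I a \<longleftrightarrow> (\<forall>v. \<exists>D. derivation D \<and> (\<forall>i\<in>I. D (a i) = v i))"

lemma free_familyD:
  assumes "free_family I a"
  obtains D where "derivation D" "\<And>i. i \<in> I \<Longrightarrow> D (a i) = v i"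
  using assms unfolding free_family_def by blast

text \<open>Real combinations of derivations are derivations, so a dual family suffices: one
  derivation per index that moves only that member.\<close>

lemma free_familyI:
  assumes "finite I" "\<And>i. i \<in> I \<Longrightarrow> \<not> algebraic_over (ring_hull (a ` (I - {i}))) (a i)"
  shows "free_family I a"
  unfolding free_family_def
proof
  fix v :: "'a \<Rightarrow> real"
  have "\<forall>i\<in>I. \<exists>D. derivation D \<and> (\<forall>b\<in>a ` (I - {i}). D b = 0) \<and> D (a i) = 1"
    using assms(2) transcendental_derivation by blast
  then obtain D where D: "\<And>i. i \<in> I \<Longrightarrow> derivation (D i)"
      "\<And>i j. i \<in> I \<Longrightarrow> j \<in> I \<Longrightarrow> j \<noteq> i \<Longrightarrow> D i (a j) = 0" "\<And>i. i \<in> I \<Longrightarrow> D i (a i) = 1"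
    by (metis DiffI image_eqI singletonD)
  define D' where "D' r = (\<Sum>i\<in>I. v i * D i r)" for r
  have "derivation D'"
    unfolding derivation_def D'_def
    by (auto simp: derivation_add[OF D(1)] derivation_mult[OF D(1)] ring_distribs sum.distrib
        sum_distrib_left sum_distrib_right mult_ac)
  moreover have "D' (a j) = v j" if "j \<in> I" for j
  proof -
    have "D' (a j) = (\<Sum>i\<in>I. if i = j then v i else 0)"
      unfolding D'_def by (rule sum.cong) (use D that in auto)
    then show ?thesis using assms(1) that by simp
  qed
  ultimately show "\<exists>D. derivation D \<and> (\<forall>i\<in>I. D (a i) = v i)" by blast
qed

lemma free_family_transcendental:
  assumes "free_family I a" "i \<in> I"
  shows "\<not> algebraic_over (ring_hull (a ` (I - {i}))) (a i)"
proof
  assume *: "algebraic_over (ring_hull (a ` (I - {i}))) (a i)"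
  obtain D where D: "derivation D" "\<And>j. j \<in> I \<Longrightarrow> D (a j) = (if j = i then 1 else 0)"
    using free_familyD[OF assms(1), where v = "\<lambda>j. if j = i then 1 else 0"] by blast
  have "D (a i) = 0"
    by (rule derivation_algebraic[OF D(1) _ *]) (use D(2) in \<open>auto split: if_splits\<close>)
  then show False
    using D(2) assms(2) by simp
qed

section \<open>Linear systems and dimension counts\<close>

text \<open>Gaussian elimination: equation \<open>e\<close> is solved for an unknown
  \<open>j\<close> with nonzero coefficient, which is then substituted into the other
  equations.\<close>

lemma nontrivial_kernel:
  fixes A :: "'e \<Rightarrow> 'i \<Rightarrow> real"
  assumes "finite E" "finite I" "card E < card I"
  shows "\<exists>z. (\<exists>i\<in>I. z i \<noteq> 0) \<and> (\<forall>e\<in>E. (\<Sum>i\<in>I. A e i * z i) = 0)"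
  using assms
proof (induction E arbitrary: I A rule: finite_induct)
  case empty
  then show ?case by (intro exI[of _ "\<lambda>_. 1"]) (auto simp: card_gt_0_iff)
next
  case (insert e E)
  show ?case
  proof (cases "\<forall>i\<in>I. A e i = 0")
    case True
    then show ?thesis using insert.IH[of I A] insert.hyps insert.prems by auto
  next
    case False
    then obtain j where j: "j \<in> I" "A e j \<noteq> 0" by blast
    have "card E < card (I - {j})"
      using insert j by simp
    then obtain z where z: "\<exists>i\<in>I - {j}. z i \<noteq> 0"
      and zE: "\<forall>f\<in>E. (\<Sum>i\<in>I - {j}. (A f i - A f j / A e j * A e i) * z i) = 0"
      using insert.IH[of "I - {j}" "\<lambda>f i. A f i - A f j / A e j * A e i"] insert.prems by auto
    define t where "t = - (\<Sum>i\<in>I - {j}. A e i * z i) / A e j"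
    define z' where "z' = z(j := t)"
    have sum: "(\<Sum>i\<in>I. A f i * z' i) = A f j * t + (\<Sum>i\<in>I - {j}. A f i * z i)" for f
      using insert.prems j by (subst sum.remove[of I j]) (auto simp: z'_def intro!: sum.cong)
    have "(\<Sum>i\<in>I. A f i * z' i) = 0" if "f \<in> E" for f
    proof -
      have "(\<Sum>i\<in>I - {j}. A f i * z i) = A f j / A e j * (\<Sum>i\<in>I - {j}. A e i * z i)"
        using zE that by (simp add: left_diff_distrib sum_subtractf sum_distrib_left mult.assoc)
      then show ?thesis unfolding sum by (simp add: t_def)
    qed
    moreover have "(\<Sum>i\<in>I. A e i * z' i) = 0"
      unfolding sum using j by (simp add: t_def)
    moreover have "\<exists>i\<in>I. z' i \<noteq> 0" using z by (auto simp: z'_def)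
    ultimately show ?thesis by blast
  qed
qed

text \<open>A bound on transcendence degree. With more \<open>a\<close> than \<open>b\<close>, some
  nonzero combination of the derivations dual to \<open>a\<close> kills every \<open>b\<close>,
  hence every \<open>a\<close>, although its values on \<open>a\<close> are its own
  coefficients.\<close>

lemma free_family_card_le:
  assumes fin: "finite A" "finite B" and free: "free_family A a"
    and dep: "\<And>D i. derivation D \<Longrightarrow> \<forall>j\<in>B. D (b j) = 0 \<Longrightarrow> i \<in> A \<Longrightarrow> D (a i) = 0"
  shows "card A \<le> card B"
proof (rule ccontr)
  assume "\<not> card A \<le> card B"
  then have lt: "card B < card A" by simp
  have "\<forall>i. \<exists>D. derivation D \<and> (\<forall>j\<in>A. D (a j) = (if j = i then 1 else 0))"
    using free unfolding free_family_def by simp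
  then obtain D where D: "\<And>i. derivation (D i)" "\<And>i j. j \<in> A \<Longrightarrow> D i (a j) = (if j = i then 1 else 0)"
    by metis
  obtain z where z: "\<exists>i\<in>A. z i \<noteq> 0" "\<forall>j\<in>B. (\<Sum>i\<in>A. D i (b j) * z i) = 0"
    using nontrivial_kernel[OF fin(2,1) lt, of "\<lambda>j i. D i (b j)"] by blast
  define D' where "D' r = (\<Sum>i\<in>A. D i r * z i)" for r
  have "derivation D'"
    unfolding derivation_def D'_def
    by (auto simp: derivation_add[OF D(1)] derivation_mult[OF D(1)] ring_distribs sum.distrib
        sum_distrib_left sum_distrib_right mult_ac)
  moreover have "\<forall>j\<in>B. D' (b j) = 0"
    using z(2) by (simp add: D'_def)
  ultimately have "D' (a i) = 0" if "i \<in> A" for i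
    using dep that by blast
  moreover have "D' (a i) = z i" if "i \<in> A" for i
    using that fin unfolding D'_def by (simp add: D(2) if_distrib[of "\<lambda>t. t * _"] cong: if_cong)
  ultimately show False using z(1) by auto
qed

text \<open>The domain may have infinite dimension, so the argument runs over the finitely many
  functionals. If \<open>L e\<close> vanished on the common kernel of the others, projecting along
  the dual vectors \<open>d f\<close> would express it through them, a relation with coefficient
  \<open>-1\<close> at \<open>e\<close>.\<close>

lemma functionals_dependent_or_surjective:
  fixes L :: "'e \<Rightarrow> ('b \<Rightarrow> 'v::real_vector) \<Rightarrow> real"
  assumes "finite E"
    and lin: "\<And>e m m' c. L e (\<lambda>v. m v + c *\<^sub>R m' v) = L e m + c * L e m'"
    and indep: "\<And>w. (\<And>m. (\<Sum>e\<in>E. w e * L e m) = 0) \<Longrightarrow> \<forall>e\<in>E. w e = 0"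
  shows "\<exists>m. \<forall>e\<in>E. L e m = b e"
  using assms(1) indep
proof (induction E arbitrary: b rule: finite_induct)
  case empty
  then show ?case by simp
next
  case (insert e E)
  have IH: "\<exists>m. \<forall>e\<in>E. L e m = b e" for b
  proof (rule insert.IH)
    fix w assume w: "\<And>m. (\<Sum>e\<in>E. w e * L e m) = 0"
    have "\<forall>f\<in>insert e E. (w(e := 0)) f = 0"
    proof (rule insert.prems)
      fix m
      have "(\<Sum>f\<in>E. (w(e := 0)) f * L f m) = (\<Sum>f\<in>E. w f * L f m)"
        using insert.hyps by (intro sum.cong) auto
      then show "(\<Sum>f\<in>insert e E. (w(e := 0)) f * L f m) = 0"
        using insert.hyps w by simp
    qed
    then show "\<forall>f\<in>E. w f = 0" using insert.hyps by (metis fun_upd_other insertI2)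
  qed
  have "\<exists>m0. (\<forall>f\<in>E. L f m0 = 0) \<and> L e m0 \<noteq> 0"
  proof (rule ccontr)
    assume "\<not> ?thesis"
    then have ker: "L e m = 0" if "\<forall>f\<in>E. L f m = 0" for m using that by blast
    have "\<forall>f. \<exists>m. \<forall>g\<in>E. L g m = (if g = f then 1 else 0)"
      by (intro allI IH)
    then obtain d where d: "\<And>f g. g \<in> E \<Longrightarrow> L g (d f) = (if g = f then 1 else 0)" by metis
    have lins: "L g (\<lambda>v. m v + (\<Sum>f\<in>F. c f *\<^sub>R d f v)) = L g m + (\<Sum>f\<in>F. c f * L g (d f))"
      if "finite F" for F g m c
      using that
    proof (induction F rule: finite_induct)
      case empty
      then show ?case by simp
    next
      case (insert h F)
      have "(\<lambda>v. m v + (\<Sum>f\<in>insert h F. c f *\<^sub>R d f v))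
          = (\<lambda>v. (m v + (\<Sum>f\<in>F. c f *\<^sub>R d f v)) + c h *\<^sub>R d h v)"
        using insert.hyps by (auto simp: algebra_simps)
      then show ?case using insert lin by simp
    qed
    have "L e m = (\<Sum>f\<in>E. L f m * L e (d f))" for m
    proof -
      define m' where "m' v = m v + (\<Sum>f\<in>E. (- L f m) *\<^sub>R d f v)" for v
      have m': "L g m' = L g m - (\<Sum>f\<in>E. L f m * L g (d f))" for g
        using lins[OF insert.hyps(1), of g m "\<lambda>f. - L f m"] by (simp add: m'_def[abs_def] sum_negf)
      have "L g m' = 0" if "g \<in> E" for g
        unfolding m' using that insert.hyps
        by (simp add: d if_distrib[of "\<lambda>t. _ * t"] cong: if_cong)
      then have "L e m' = 0" using ker by blast
      then show ?thesis using m'[of e] by simp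
    qed
    then have "(\<Sum>f\<in>insert e E. (if f = e then -1 else L e (d f)) * L f m) = 0" for m
    proof -
      have "(\<Sum>f\<in>E. (if f = e then -1 else L e (d f)) * L f m) = (\<Sum>f\<in>E. L f m * L e (d f))"
        using insert.hyps by (intro sum.cong) auto
      then show ?thesis using insert.hyps \<open>L e m = (\<Sum>f\<in>E. L f m * L e (d f))\<close> by simp
    qed
    then have "\<forall>f\<in>insert e E. (if f = e then -1 else L e (d f)) = 0"
      by (rule insert.prems)
    then show False by force
  qed
  then obtain m0 where m0: "\<And>f. f \<in> E \<Longrightarrow> L f m0 = 0" "L e m0 \<noteq> 0" by blast
  obtain m where m: "\<And>f. f \<in> E \<Longrightarrow> L f m = b f" using IH by blast
  define c where "c = (b e - L e m) / L e m0"
  have "\<forall>f\<in>insert e E. L f (\<lambda>v. m v + c *\<^sub>R m0 v) = b f"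
    unfolding lin using m0 m by (auto simp: c_def)
  then show ?case by blast
qed

section \<open>Algebraic independence\<close>

lemma sum_fun_apply: "(\<Sum>i\<in>I. f i) y = (\<Sum>i\<in>I. f i y)"
  for f :: "'i \<Rightarrow> 'b \<Rightarrow> 'c::comm_ring_1"
  by (induction I rule: infinite_finite_induct) auto

lemma power_fun_apply: "(f ^ k) y = f y ^ k"
  for f :: "'b \<Rightarrow> 'c::comm_ring_1"
  by (induction k) auto

text \<open>Here \<open>y\<close> acts as a generic point: functions of the ring that vanish at
  \<open>y\<close> are zero, so an algebraic relation between values at \<open>y\<close> lifts to an
  identity at all points \<open>z\<close>.\<close>

lemma polynomial_relation:
  fixes C :: "('b \<Rightarrow> real) set"
  assumes inj: "\<And>f. f \<in> ring_hull C \<Longrightarrow> f y = 0 \<Longrightarrow> f = 0"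
    and F: "F \<subseteq> ring_hull C" and g: "g \<in> ring_hull C"
    and alg: "algebraic_over (ring_hull ((\<lambda>f. f y) ` F)) (g y)"
  shows "\<exists>h N. (\<forall>k. h k \<in> ring_hull F) \<and> (\<exists>k\<le>N. h k y \<noteq> 0) \<and>
    (\<forall>z. (\<Sum>k\<le>N. h k z * g z ^ k) = 0)"
proof -
  obtain P where P: "P \<noteq> 0" "\<And>k. coeff P k \<in> ring_hull ((\<lambda>f. f y) ` F)" "poly P (g y) = 0"
    using alg by (auto simp: algebraic_over_def)
  have "\<forall>k. \<exists>f\<in>ring_hull F. coeff P k = f y"
    using P(2) by (auto simp: ring_hull_eval)
  then obtain h where h: "\<And>k. h k \<in> ring_hull F" "\<And>k. coeff P k = h k y"
    by metis
  define \<phi> where "\<phi> = (\<Sum>k\<le>degree P. h k * g ^ k)"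
  have "ring_hull F \<subseteq> ring_hull C" using F by (rule ring_hull_subset)
  then have "\<phi> \<in> ring_hull C"
    unfolding \<phi>_def using h(1) g by (intro ring_hull_sum ring_hull.mult ring_hull_power) auto
  moreover have "\<phi> z = (\<Sum>k\<le>degree P. h k z * g z ^ k)" for z
    by (simp add: \<phi>_def sum_fun_apply power_fun_apply)
  moreover from this have "\<phi> y = 0"
    using P(3) by (simp add: poly_altdef h(2))
  ultimately have "(\<Sum>k\<le>degree P. h k z * g z ^ k) = 0" for z
    using inj by (metis zero_fun_apply)
  moreover have "\<exists>k\<le>degree P. h k y \<noteq> 0"
    using P(1) h(2) by (metis leading_coeff_0_iff order_refl)
  ultimately show ?thesis using h(1) by blast
qed

lemma ring_hull_fun_cong:
  fixes F :: "('b \<Rightarrow> real) set"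
  assumes "h \<in> ring_hull F" "\<And>f. f \<in> F \<Longrightarrow> f y = f z"
  shows "h y = h z"
  using assms(1) by induction (auto simp: assms(2))

lemma algebraic_overI:
  assumes "\<And>k. a k \<in> ring_hull S" "\<exists>k\<le>N. a k \<noteq> 0" "(\<Sum>k\<le>N. a k * t ^ k) = 0"
  shows "algebraic_over (ring_hull S) t"
proof -
  define P where "P = (\<Sum>k\<le>N. monom (a k) k)"
  have c: "coeff P k = (if k \<le> N then a k else 0)" for k
    by (simp add: P_def coeff_sum)
  then have "P \<noteq> 0" using assms(2) by (metis coeff_0)
  moreover have "poly P t = 0"
    using assms(3) by (simp add: P_def poly_sum poly_monom)
  ultimately show ?thesis
    using c assms(1) ring_hull_zero unfolding algebraic_over_def by (intro exI[of _ P]) auto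
qed

text \<open>The identity found at \<open>y\<close> is evaluated at \<open>z\<close>. It stays
  nontrivial, since a coefficient nonzero at \<open>y\<close> is a nonzero function and
  \<open>z\<close> is generic too.\<close>

lemma algebraic_transfer:
  fixes C :: "('b \<Rightarrow> real) set"
  assumes "\<And>f. f \<in> ring_hull C \<Longrightarrow> f y = 0 \<Longrightarrow> f = 0" "\<And>f. f \<in> ring_hull C \<Longrightarrow> f z = 0 \<Longrightarrow> f = 0"
    and F: "F \<subseteq> ring_hull C" and "g \<in> ring_hull C"
    and "algebraic_over (ring_hull ((\<lambda>f. f y) ` F)) (g y)"
  shows "algebraic_over (ring_hull ((\<lambda>f. f z) ` F)) (g z)"
proof -
  obtain N h where h: "\<And>k. h k \<in> ring_hull F" "\<exists>k\<le>N. h k y \<noteq> 0"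
    "\<And>z. (\<Sum>k\<le>N. h k z * g z ^ k) = 0"
    using polynomial_relation[OF assms(1,3,4,5)] by blast
  obtain k where "k \<le> N" "h k y \<noteq> 0" using h(2) by blast
  moreover from this have "h k z \<noteq> 0"
    using assms(2)[of "h k"] h(1)[of k] ring_hull_subset[OF F] by auto
  ultimately show ?thesis
    using h(1,3) by (intro algebraic_overI[of "\<lambda>k. h k z" _ N]) (auto simp: ring_hull_eval)
qed

lemma alg_indep_QD:
  assumes "alg_indep_Q I y" "finite {m. c m \<noteq> 0}" "\<forall>m. c m \<noteq> 0 \<longrightarrow> (\<forall>i. i \<notin> I \<longrightarrow> m i = 0)"
    and "(\<Sum>m\<in>{m. c m \<noteq> 0}. of_rat (c m) * (\<Prod>i\<in>I. y i ^ m i)) = 0"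
  shows "c m = 0"
  using assms unfolding alg_indep_Q_def by blast

definition monomial_value :: "'i set \<Rightarrow> ('i \<Rightarrow> nat) \<Rightarrow> ('i \<Rightarrow> real) \<Rightarrow> real" where
  "monomial_value I m y = (\<Prod>i\<in>I. y i ^ m i)"

lemma sum_list_times_sum_list:
  "sum_list (map f xs) * sum_list (map g ys)
     = sum_list (map (\<lambda>(x, y). f x * g y) (List.product xs ys))"
  for f :: "'x \<Rightarrow> 'r::comm_ring_1"
  by (induction xs) (simp_all add: distrib_right comp_def sum_list_const_mult)

text \<open>Lists of terms may repeat monomials, so differences are concatenations and products run
  over pairs of terms; like terms are collected only afterwards.\<close>

lemma polynomial_function_terms:
  assumes "finite I" "f \<in> ring_hull ((\<lambda>i y. y i) ` I)"
  shows "\<exists>xs. (\<forall>(r, m)\<in>set xs. \<forall>i. i \<notin> I \<longrightarrow> m i = 0) \<and>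
    (\<forall>y. f y = (\<Sum>(r, m)\<leftarrow>xs. of_rat r * monomial_value I m y))"
  using assms(2)
proof induction
  case one
  show ?case
    by (intro exI[of _ "[(1, \<lambda>_. 0)]"]) (auto simp: monomial_value_def)
next
  case (gen f)
  then obtain j where j: "j \<in> I" "f = (\<lambda>y. y j)" by auto
  have "monomial_value I (\<lambda>i. if i = j then 1 else 0) y = (\<Prod>i\<in>I. if i = j then y i else 1)" for y
    unfolding monomial_value_def by (rule prod.cong) auto
  then show ?case using j assms(1)
    by (intro exI[of _ "[(1, \<lambda>i. if i = j then 1 else 0)]"]) auto
next
  case (diff f g)
  then obtain xs ys where
      xs: "\<forall>(r, m)\<in>set xs. \<forall>i. i \<notin> I \<longrightarrow> m i = 0" "\<And>y. f y = (\<Sum>(r, m)\<leftarrow>xs. of_rat r * monomial_value I m y)"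
    and ys: "\<forall>(r, m)\<in>set ys. \<forall>i. i \<notin> I \<longrightarrow> m i = 0" "\<And>y. g y = (\<Sum>(r, m)\<leftarrow>ys. of_rat r * monomial_value I m y)"
    by blast
  have "(\<Sum>(r, m)\<leftarrow>map (\<lambda>(r, m). (- r, m)) ys. of_rat r * monomial_value I m y) = - g y" for y
    unfolding ys(2) by (induction ys) (auto simp: of_rat_minus)
  then show ?case using xs ys
    by (intro exI[of _ "xs @ map (\<lambda>(r, m). (- r, m)) ys"]) auto
next
  case (mult f g)
  then obtain xs ys where
      xs: "\<forall>(r, m)\<in>set xs. \<forall>i. i \<notin> I \<longrightarrow> m i = 0" "\<And>y. f y = (\<Sum>(r, m)\<leftarrow>xs. of_rat r * monomial_value I m y)"
    and ys: "\<forall>(r, m)\<in>set ys. \<forall>i. i \<notin> I \<longrightarrow> m i = 0" "\<And>y. g y = (\<Sum>(r, m)\<leftarrow>ys. of_rat r * monomial_value I m y)"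
    by blast
  define zs where "zs = map (\<lambda>((r, m), (s, k)). (r * s, \<lambda>i. m i + k i)) (List.product xs ys)"
  have "f y * g y = (\<Sum>(r, m)\<leftarrow>zs. of_rat r * monomial_value I m y)" for y
    unfolding xs(2) ys(2) sum_list_times_sum_list zs_def map_map
    by (intro arg_cong[where f = sum_list] map_cong)
      (auto simp: monomial_value_def of_rat_mult power_add prod.distrib)
  moreover have "\<forall>(r, m)\<in>set zs. \<forall>i. i \<notin> I \<longrightarrow> m i = 0"
    using xs(1) ys(1) by (fastforce simp: zs_def)
  ultimately show ?case by (intro exI[of _ zs]) auto
qed

lemma alg_indep_Q_polynomial_function:
  assumes "finite I" "alg_indep_Q I y" "f \<in> ring_hull ((\<lambda>i y. y i) ` I)" "f y = 0"
  shows "f = 0"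
proof -
  obtain xs where xs: "\<forall>(r, m)\<in>set xs. \<forall>i. i \<notin> I \<longrightarrow> m i = 0"
    and f: "\<And>z. f z = (\<Sum>(r, m)\<leftarrow>xs. of_rat r * monomial_value I m z)"
    using polynomial_function_terms[OF assms(1,3)] by blast
  \<comment> \<open>Collecting the terms with exponent \<open>m\<close> yields the finitely
    supported coefficients that \<open>alg_indep_Q\<close> requires.\<close>
  define c where "c m = (\<Sum>(r, k)\<leftarrow>xs. if k = m then r else 0)" for m
  have c0: "c m = 0" if "m \<notin> snd ` set xs" for m
  proof -
    have "map (\<lambda>(r, k). if k = m then r else 0) xs = map (\<lambda>_. 0) xs"
      using that by (intro map_cong) force+
    then show ?thesis unfolding c_def by (simp only: sum_list_0)
  qed
  have expand: "f z = (\<Sum>m\<in>snd ` set xs. of_rat (c m) * monomial_value I m z)" for z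
  proof -
    have "(\<Sum>m\<in>M. of_rat (\<Sum>(r, k)\<leftarrow>ys. if k = m then r else 0) * monomial_value I m z)
        = (\<Sum>(r, m)\<leftarrow>ys. of_rat r * monomial_value I m z)"
      if "finite M" "snd ` set ys \<subseteq> M" for M and ys :: "(rat \<times> ('a \<Rightarrow> nat)) list"
      using that(2)
    proof (induction ys)
      case Nil
      then show ?case by simp
    next
      case (Cons a ys)
      obtain r k where a: "a = (r, k)" by (cases a)
      have "(\<Sum>m\<in>M. of_rat (if k = m then r else 0) * monomial_value I m z)
          = (\<Sum>m\<in>M. if m = k then of_rat r * monomial_value I m z else 0)"
        by (rule sum.cong) auto
      then have "(\<Sum>m\<in>M. of_rat (if k = m then r else 0) * monomial_value I m z)
          = of_rat r * monomial_value I k z"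
        using that(1) Cons.prems by (simp add: a)
      then show ?case
        using Cons by (simp add: a of_rat_add distrib_right sum.distrib)
    qed
    then show ?thesis unfolding f c_def by simp
  qed
  have supp: "{m. c m \<noteq> 0} \<subseteq> snd ` set xs" using c0 by blast
  have val: "(\<Sum>m\<in>{m. c m \<noteq> 0}. of_rat (c m) * (\<Prod>i\<in>I. y i ^ m i)) = f y"
    unfolding expand monomial_value_def
    by (rule sum.mono_neutral_left) (use supp in auto)
  have "\<forall>m. c m \<noteq> 0 \<longrightarrow> (\<forall>i. i \<notin> I \<longrightarrow> m i = 0)"
    using supp xs by fastforce
  moreover have "finite {m. c m \<noteq> 0}" using supp by (rule finite_subset) simp
  ultimately have "c m = 0" for m
    using alg_indep_QD[OF assms(2)] val[unfolded assms(4)] by blast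
  then show ?thesis unfolding fun_eq_iff expand by simp
qed

text \<open>A dependence of \<open>y i\<close> on the other coordinates would be a polynomial
  identity. Moving only the \<open>i\<close>-th coordinate keeps its coefficients fixed, so a
  nonzero polynomial in one variable would vanish everywhere.\<close>

lemma alg_indep_Q_free:
  assumes "finite I" "alg_indep_Q I y"
  shows "free_family I y"
proof (rule free_familyI[OF assms(1)])
  fix i assume i: "i \<in> I"
  let ?X = "\<lambda>i (y :: 'a \<Rightarrow> real). y i"
  show "\<not> algebraic_over (ring_hull (y ` (I - {i}))) (y i)"
  proof
    assume "algebraic_over (ring_hull (y ` (I - {i}))) (y i)"
    then have alg: "algebraic_over (ring_hull ((\<lambda>f. f y) ` ?X ` (I - {i}))) (?X i y)"
      by (simp add: image_image)
    obtain N h where h: "\<And>k. h k \<in> ring_hull (?X ` (I - {i}))" "\<exists>k\<le>N. h k y \<noteq> 0"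
      "\<And>z. (\<Sum>k\<le>N. h k z * ?X i z ^ k) = 0"
    proof -
      have "f = 0" if "f \<in> ring_hull (?X ` I)" "f y = 0" for f
        using alg_indep_Q_polynomial_function[OF assms that] .
      moreover have "?X ` (I - {i}) \<subseteq> ring_hull (?X ` I)" "?X i \<in> ring_hull (?X ` I)"
        using i by (auto intro: ring_hull.gen)
      ultimately show thesis
        using polynomial_relation[of "?X ` I" y "?X ` (I - {i})" "?X i"] alg that by blast
    qed
    define P where "P = (\<Sum>k\<le>N. monom (h k y) k)"
    have "poly P t = 0" for t
    proof -
      have "h k (y(i := t)) = h k y" for k
      proof (rule ring_hull_fun_cong[OF h(1)])
        fix f assume "f \<in> ?X ` (I - {i})"
        then obtain j where "j \<noteq> i" "f = ?X j" by blast
        then show "f (y(i := t)) = f y" by simp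
      qed
      then show ?thesis
        using h(3)[of "y(i := t)"] by (simp add: P_def poly_sum poly_monom)
    qed
    then have "P = 0" by (simp add: poly_all_0_iff_0[symmetric])
    moreover have "coeff P k = (if k \<le> N then h k y else 0)" for k
      by (simp add: P_def coeff_sum)
    ultimately show False using h(2) by (metis coeff_0)
  qed
qed

section \<open>Density of algebraically independent points\<close>

text \<open>Each element is a sum of products of members of \<open>S\<close> and \<open>-1\<close>,
  hence encoded by a list of lists.\<close>

lemma countable_ring_hull:
  assumes "countable S"
  shows "countable (ring_hull S)"
proof -
  let ?v = "\<lambda>xss. \<Sum>xs\<leftarrow>xss. prod_list xs"
  let ?X = "lists (lists (insert (- 1) S))"
  have "ring_hull S \<subseteq> ?v ` ?X"
  proof
    fix a assume "a \<in> ring_hull S"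
    then show "a \<in> ?v ` ?X"
    proof induction
      case one
      show ?case by (rule image_eqI[of _ _ "[[]]"]) auto
    next
      case (gen a)
      then show ?case by (intro image_eqI[of _ _ "[[a]]"]) auto
    next
      case (diff a b)
      then obtain xss yss where xy: "xss \<in> ?X" "a = ?v xss" "yss \<in> ?X" "b = ?v yss" by auto
      have "?v (map ((#) (- 1)) yss) = - ?v yss" by (induction yss) auto
      then have "a - b = ?v (xss @ map ((#) (- 1)) yss)" using xy(2,4) by simp
      moreover have "xss @ map ((#) (- 1)) yss \<in> ?X" using xy(1,3) by fastforce
      ultimately show ?case by blast
    next
      case (mult a b)
      then obtain xss yss where xy: "xss \<in> ?X" "a = ?v xss" "yss \<in> ?X" "b = ?v yss" by auto
      then have "a * b = ?v (map (\<lambda>(xs, ys). xs @ ys) (List.product xss yss))"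
        by (simp add: sum_list_times_sum_list comp_def case_prod_unfold)
      moreover have "map (\<lambda>(xs, ys). xs @ ys) (List.product xss yss) \<in> ?X"
        using xy(1,3) by fastforce
      ultimately show ?case by blast
    qed
  qed
  then show ?thesis
    by (rule countable_subset) (use assms in auto)
qed

lemma countable_algebraic_over:
  assumes "countable A"
  shows "countable {t. algebraic_over A t}"
proof -
  have "{P. \<forall>k. coeff P k \<in> A} \<subseteq> Poly ` lists A"
  proof
    fix P assume "P \<in> {P. \<forall>k. coeff P k \<in> A}"
    then have "coeffs P \<in> lists A" by (auto simp: coeffs_def)
    then show "P \<in> Poly ` lists A" by (metis Poly_coeffs imageI)
  qed
  then have "countable {P. \<forall>k. coeff P k \<in> A}"
    by (rule countable_subset) (use assms in auto)
  then have "countable (\<Union>P\<in>{P. \<forall>k. coeff P k \<in> A} - {0}. {t. poly P t = 0})"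
    by (intro countable_UN) (auto intro!: countable_finite poly_roots_finite)
  then show ?thesis
    by (rule countable_subset[rotated]) (auto simp: algebraic_over_def)
qed

lemma alg_indep_Q_insert:
  assumes fin: "finite I" and j: "j \<notin> I" and indep: "alg_indep_Q I y"
    and t: "\<not> algebraic_over (ring_hull (\<rat> \<union> y ` I)) t"
  shows "alg_indep_Q (insert j I) (y(j := t))"
  unfolding alg_indep_Q_def
proof (rule allI, rule impI, elim conjE, rule ccontr)
  fix c :: "('a \<Rightarrow> nat) \<Rightarrow> rat"
  let ?S = "{m. c m \<noteq> 0}"
  assume finS: "finite ?S" and supp: "\<forall>m. c m \<noteq> 0 \<longrightarrow> (\<forall>i. i \<notin> insert j I \<longrightarrow> m i = 0)"
    and sum0: "(\<Sum>m\<in>?S. of_rat (c m) * (\<Prod>i\<in>insert j I. (y(j := t)) i ^ m i)) = 0"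
    and "\<not> (\<forall>m. c m = 0)"
  then obtain m0 where m0: "c m0 \<noteq> 0" by blast
  have mv: "(\<Prod>i\<in>insert j I. (y(j := t)) i ^ m i) = t ^ m j * (\<Prod>i\<in>I. y i ^ m i)" for m
  proof -
    have "(\<Prod>i\<in>I. (y(j := t)) i ^ m i) = (\<Prod>i\<in>I. y i ^ m i)"
      using j by (intro prod.cong) auto
    then show ?thesis using fin j by simp
  qed
  \<comment> \<open>The coefficient of \<open>t ^ k\<close>. The rationals are among the generators
    of the subring because \<open>ring_hull\<close> by itself supplies only integers.\<close>
  define a where "a k = (\<Sum>m\<in>{m\<in>?S. m j = k}. of_rat (c m) * (\<Prod>i\<in>I. y i ^ m i))" for k
  define N where "N = Max ((\<lambda>m. m j) ` ?S)"
  have N: "m j \<le> N" if "c m \<noteq> 0" for m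
    unfolding N_def using finS that by (intro Max_ge) auto
  have "algebraic_over (ring_hull (\<rat> \<union> y ` I)) t"
  proof (rule algebraic_overI)
    show "a k \<in> ring_hull (\<rat> \<union> y ` I)" for k
      unfolding a_def
      by (intro ring_hull_sum ring_hull.mult ring_hull_prod ring_hull_power) (auto intro: ring_hull.gen)
    show "(\<Sum>k\<le>N. a k * t ^ k) = 0"
    proof -
      have "(\<Sum>k\<le>N. a k * t ^ k)
          = (\<Sum>k\<le>N. \<Sum>m\<in>{m\<in>?S. m j = k}. of_rat (c m) * (t ^ m j * (\<Prod>i\<in>I. y i ^ m i)))"
        unfolding a_def sum_distrib_right by (intro sum.cong) (auto simp: mult_ac)
      also have "\<dots> = (\<Sum>m\<in>?S. of_rat (c m) * (t ^ m j * (\<Prod>i\<in>I. y i ^ m i)))"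
        by (rule sum.group) (use finS N in auto)
      also have "\<dots> = 0" using sum0 unfolding mv .
      finally show ?thesis .
    qed
    show "\<exists>k\<le>N. a k \<noteq> 0"
    proof (intro exI conjI)
      show "m0 j \<le> N" using N m0 .
      show "a (m0 j) \<noteq> 0"
      proof
        assume a0: "a (m0 j) = 0"
        \<comment> \<open>The terms of degree \<open>m0 j\<close> in the new variable, with that
          exponent reset to 0, since independence on \<open>I\<close> admits only exponents that
          vanish outside \<open>I\<close>.\<close>
        define c' where "c' m = (if m j = 0 then c (m(j := m0 j)) else 0)" for m
        have inj: "inj_on (\<lambda>m. m(j := m0 j)) {m. c' m \<noteq> 0}"
        proof (rule inj_onI)
          fix m m' assume "m \<in> {m. c' m \<noteq> 0}" "m' \<in> {m. c' m \<noteq> 0}" "m(j := m0 j) = m'(j := m0 j)"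
          moreover from this have "m j = 0" "m' j = 0" by (auto simp: c'_def split: if_splits)
          ultimately show "m = m'" by (metis fun_upd_triv fun_upd_upd)
        qed
        have img: "(\<lambda>m. m(j := m0 j)) ` {m. c' m \<noteq> 0} = {m\<in>?S. m j = m0 j}"
        proof (intro equalityI subsetI)
          fix m assume "m \<in> {m\<in>?S. m j = m0 j}"
          then show "m \<in> (\<lambda>m. m(j := m0 j)) ` {m. c' m \<noteq> 0}"
            by (intro image_eqI[of _ _ "m(j := 0)"]) (auto simp: c'_def fun_upd_idem)
        qed (auto simp: c'_def split: if_splits)
        have "(\<Sum>m\<in>{m. c' m \<noteq> 0}. of_rat (c' m) * (\<Prod>i\<in>I. y i ^ m i)) = 0"
          unfolding a0[symmetric] a_def img[symmetric] sum.reindex[OF inj] comp_def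
        proof (rule sum.cong)
          fix m assume "m \<in> {m. c' m \<noteq> 0}"
          then have "c' m = c (m(j := m0 j))" by (auto simp: c'_def split: if_splits)
          moreover have "(\<Prod>i\<in>I. y i ^ m i) = (\<Prod>i\<in>I. y i ^ (m(j := m0 j)) i)"
            using j by (intro prod.cong) auto
          ultimately show "of_rat (c' m) * (\<Prod>i\<in>I. y i ^ m i)
              = of_rat (c (m(j := m0 j))) * (\<Prod>i\<in>I. y i ^ (m(j := m0 j)) i)" by simp
        qed simp
        moreover have "finite {m. c' m \<noteq> 0}"
          using finite_imageD[OF _ inj] img finS by simp
        moreover have "\<forall>m. c' m \<noteq> 0 \<longrightarrow> (\<forall>i. i \<notin> I \<longrightarrow> m i = 0)"
        proof (intro allI impI)
          fix m i assume "c' m \<noteq> 0" "i \<notin> I"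
          then have "m j = 0" "c (m(j := m0 j)) \<noteq> 0" by (auto simp: c'_def split: if_splits)
          then show "m i = 0" using supp \<open>i \<notin> I\<close> by (cases "i = j") force+
        qed
        ultimately have "c' (m0(j := 0)) = 0"
          using alg_indep_QD[OF indep] by blast
        then show False using m0 by (simp add: c'_def)
      qed
    qed
  qed
  then show False using t by blast
qed

text \<open>Coordinates are chosen one after another: the values algebraic over the earlier ones are
  countable, an open interval is not.\<close>

lemma alg_indep_Q_dense:
  assumes "finite I" "\<epsilon> > 0"
  shows "\<exists>y. alg_indep_Q I y \<and> (\<forall>i\<in>I. \<bar>y i - y0 i\<bar> < \<epsilon>)"
  using assms(1)
proof (induction I rule: finite_induct)
  case empty
  have "alg_indep_Q {} y" for y :: "'a \<Rightarrow> real"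
    unfolding alg_indep_Q_def
  proof (intro allI impI, elim conjE)
    fix c :: "('a \<Rightarrow> nat) \<Rightarrow> rat" and m
    assume "finite {m. c m \<noteq> 0}" and supp: "\<forall>m. c m \<noteq> 0 \<longrightarrow> (\<forall>i. i \<notin> {} \<longrightarrow> m i = 0)"
      and sum: "(\<Sum>m\<in>{m. c m \<noteq> 0}. of_rat (c m) * (\<Prod>i\<in>{}. y i ^ m i)) = 0"
    have "{m. c m \<noteq> 0} = (if c (\<lambda>_. 0) = 0 then {} else {\<lambda>_. 0})"
      using supp by (auto simp: fun_eq_iff) (metis ext)+
    with sum have "c (\<lambda>_. 0) = 0" by (auto split: if_splits)
    moreover have "m = (\<lambda>_. 0)" if "c m \<noteq> 0" using supp that by auto
    ultimately show "c m = 0" by blast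
  qed
  then show ?case by auto
next
  case (insert j I)
  then obtain y where y: "alg_indep_Q I y" "\<forall>i\<in>I. \<bar>y i - y0 i\<bar> < \<epsilon>" by blast
  have "countable {t. algebraic_over (ring_hull (\<rat> \<union> y ` I)) t}"
    by (intro countable_algebraic_over countable_ring_hull) (use insert in \<open>auto intro: countable_finite simp: countable_rat\<close>)
  moreover have "uncountable {y0 j - \<epsilon><..<y0 j + \<epsilon>}"
    using assms(2) by (intro uncountable_open_interval[THEN iffD2]) simp
  ultimately obtain t where t: "t \<in> {y0 j - \<epsilon><..<y0 j + \<epsilon>}"
      "\<not> algebraic_over (ring_hull (\<rat> \<union> y ` I)) t"
    by (metis countable_subset mem_Collect_eq subsetI)
  have "alg_indep_Q (insert j I) (y(j := t))"
    using alg_indep_Q_insert insert.hyps y(1) t(2) by metis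
  moreover have "\<forall>i\<in>insert j I. \<bar>(y(j := t)) i - y0 i\<bar> < \<epsilon>"
    using y(2) t(1) by auto
  ultimately show ?case by blast
qed

section \<open>Prescribing edge lengths near an independent framework\<close>

text \<open>Compactness instead of iteration: the displacement attains its minimum on the cube, and
  passing from a point to its image under \<open>T\<close> at least halves it, so the minimum is 0.
  The cube, a product over the whole index type, is compact by Tychonoff.\<close>

lemma contraction_fixed_point:
  fixes T :: "('e \<Rightarrow> real) \<Rightarrow> 'e \<Rightarrow> real"
  assumes "finite E" "0 \<le> r"
    and cont: "\<And>e. e \<in> E \<Longrightarrow> continuous_on UNIV (\<lambda>y. T y e)"
    and box: "\<And>y e. (\<forall>f. \<bar>y f\<bar> \<le> r) \<Longrightarrow> e \<in> E \<Longrightarrow> \<bar>T y e\<bar> \<le> r"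
    and contr: "\<And>y z. (\<forall>f. \<bar>y f\<bar> \<le> r) \<Longrightarrow> (\<forall>f. \<bar>z f\<bar> \<le> r) \<Longrightarrow>
      (\<Sum>e\<in>E. \<bar>T y e - T z e\<bar>) \<le> (\<Sum>e\<in>E. \<bar>y e - z e\<bar>) / 2"
  shows "\<exists>y. (\<forall>f. \<bar>y f\<bar> \<le> r) \<and> (\<forall>e\<in>E. T y e = y e)"
proof -
  define K where "K = PiE UNIV (\<lambda>e::'e. {-r..r})"
  have K: "y \<in> K \<longleftrightarrow> (\<forall>f. \<bar>y f\<bar> \<le> r)" for y
    by (auto simp: K_def PiE_def Pi_def abs_le_iff minus_le_iff)
  have "compactin (product_topology (\<lambda>e::'e. euclidean) UNIV) K"
    unfolding K_def compactin_PiE by simp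
  then have "compact K" by (simp add: euclidean_product_topology)
  define \<Phi> where "\<Phi> y = (\<Sum>e\<in>E. \<bar>T y e - y e\<bar>)" for y
  have "continuous_on UNIV \<Phi>"
    unfolding \<Phi>_def by (intro continuous_intros cont continuous_on_product_coordinates)
  moreover have "(\<lambda>_. 0) \<in> K" using assms(2) by (simp add: K)
  ultimately obtain y where y: "y \<in> K" "\<And>z. z \<in> K \<Longrightarrow> \<Phi> y \<le> \<Phi> z"
    using continuous_attains_inf[OF \<open>compact K\<close>, of \<Phi>] continuous_on_subset by blast
  \<comment> \<open>Coordinates outside \<open>E\<close> are set to 0 to stay in the cube; neither
    the displacement nor the contraction estimate sees them.\<close>
  define z where "z e = (if e \<in> E then T y e else 0)" for e
  have z: "z \<in> K" using y(1) box assms(2) by (auto simp: K z_def)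
  have "\<Phi> z = (\<Sum>e\<in>E. \<bar>T z e - T y e\<bar>)"
    unfolding \<Phi>_def by (rule sum.cong) (auto simp: z_def)
  also have "\<dots> \<le> (\<Sum>e\<in>E. \<bar>z e - y e\<bar>) / 2"
    using y(1) z by (intro contr) (auto simp: K)
  also have "(\<Sum>e\<in>E. \<bar>z e - y e\<bar>) = \<Phi> y"
    unfolding \<Phi>_def by (rule sum.cong) (auto simp: z_def)
  finally have "\<Phi> y \<le> 0" using y(2)[OF z] by simp
  then have "\<Phi> y = 0"
    unfolding \<Phi>_def by (intro antisym sum_nonneg) auto
  then have "\<forall>e\<in>E. \<bar>T y e - y e\<bar> = 0"
    using assms(1) unfolding \<Phi>_def by (subst (asm) sum_nonneg_eq_0_iff) auto
  then show ?thesis using y(1) by (auto simp: K)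
qed

text \<open>For an edge \<open>e = {u, v}\<close> this is \<open>(p u - p v) \<bullet> (m u - m v)\<close>: the squared edge length
  when \<open>m = p\<close>, and otherwise half of its derivative at \<open>p\<close> in direction \<open>m\<close>.\<close>

definition edge_form :: "('a \<Rightarrow> real^'n) \<Rightarrow> ('a \<Rightarrow> real^'n) \<Rightarrow> 'a set \<Rightarrow> real" where
  "edge_form p m e = (case (SOME (u, v). e = {u, v}) of (u, v) \<Rightarrow> (p u - p v) \<bullet> (m u - m v))"

text \<open>Swapping the two ends negates both factors, so the orientation picked by
  \<open>SOME\<close> is irrelevant.\<close>

lemma edge_form_pair: "edge_form p m {u, v} = (p u - p v) \<bullet> (m u - m v)"
proof -
  obtain a b where ab: "(SOME (a, b). {u, v} = {a, b}) = (a, b)" by fastforce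
  have "case (a, b) of (a, b) \<Rightarrow> {u, v} = {a, b}"
    unfolding ab[symmetric] by (rule someI[of _ "(u, v)"]) simp
  then have "a = u \<and> b = v \<or> a = v \<and> b = u" by (auto simp: doubleton_eq_iff)
  then show ?thesis
    unfolding edge_form_def ab
    by (auto simp: inner_diff_left inner_diff_right algebra_simps)
qed

lemma edge_form_linear:
  "edge_form p (\<lambda>v. m v + c *\<^sub>R m' v) e = edge_form p m e + c * edge_form p m' e"
  by (simp add: edge_form_def inner_diff_right inner_add_right algebra_simps split: prod.split)

lemma edge_form_sum:
  "finite F \<Longrightarrow> edge_form p (\<lambda>v. \<Sum>f\<in>F. c f *\<^sub>R m f v) e = (\<Sum>f\<in>F. c f * edge_form p (m f) e)"
proof (induction F rule: finite_induct)
  case empty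
  then show ?case by (simp add: edge_form_def split: prod.split)
next
  case (insert g F)
  then show ?case
    using edge_form_linear[of p "\<lambda>v. \<Sum>f\<in>F. c f *\<^sub>R m f v" "c g" "m g" e]
    by (simp add: add.commute)
qed

abbreviation sq_length :: "('a \<Rightarrow> real^'n) \<Rightarrow> 'a set \<Rightarrow> real" where
  "sq_length p e \<equiv> edge_form p p e"

lemma sq_length_pair: "sq_length p {u, v} = (dist (p u) (p v))\<^sup>2"
  by (simp add: edge_form_pair dist_norm power2_norm_eq_inner)

lemma simple_graph_edge:
  assumes "simple_graph V E" "e \<in> E"
  obtains u v where "u \<in> V" "v \<in> V" "u \<noteq> v" "e = {u, v}"
  using assms unfolding simple_graph_def by blast

lemma simple_graph_finite:
  assumes "simple_graph V E"
  shows "finite V" "finite E"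
proof -
  show "finite V" using assms by (simp add: simple_graph_def)
  moreover have "E \<subseteq> Pow V" using assms by (auto simp: simple_graph_def)
  ultimately show "finite E" by (metis finite_Pow_iff finite_subset)
qed

lemma equivalent_real_iff_sq_length:
  assumes "simple_graph V E"
  shows "equivalent_real E p q \<longleftrightarrow> (\<forall>e\<in>E. sq_length p e = sq_length q e)"
proof -
  have "dist (p u) (p v) = dist (q u) (q v) \<longleftrightarrow> sq_length p {u, v} = sq_length q {u, v}" for u v
    by (simp add: sq_length_pair)
  then have "equivalent_real E p q \<longleftrightarrow> (\<forall>u v. {u, v} \<in> E \<longrightarrow> sq_length p {u, v} = sq_length q {u, v})"
    by (simp add: equivalent_real_def)
  also have "\<dots> \<longleftrightarrow> (\<forall>e\<in>E. sq_length p e = sq_length q e)"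
  proof (intro iffI allI impI ballI)
    fix e assume *: "\<forall>u v. {u, v} \<in> E \<longrightarrow> sq_length p {u, v} = sq_length q {u, v}" and "e \<in> E"
    then show "sq_length p e = sq_length q e"
      using simple_graph_edge[OF assms \<open>e \<in> E\<close>] by blast
  qed blast
  finally show ?thesis .
qed

lemma sq_length_continuous:
  assumes "\<eta> > 0"
  shows "\<exists>\<epsilon>>0. \<forall>q. dist (q u) (p u) < \<epsilon> \<and> dist (q v) (p v) < \<epsilon> \<longrightarrow>
    \<bar>sq_length q {u, v} - sq_length p {u, v}\<bar> < \<eta>"
proof -
  define b where "b = dist (p u) (p v)"
  \<comment> \<open>The difference of the squares factors into a difference of lengths, at most
    \<open>2 * \<epsilon>\<close>, and a sum, at most \<open>2 * b + 2\<close>; the extra 1 in the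
    denominator makes the final bound strict.\<close>
  define \<epsilon> where "\<epsilon> = min 1 (\<eta> / (4 * (b + 1) + 1))"
  have b: "b \<ge> 0" by (simp add: b_def)
  then have \<epsilon>: "\<epsilon> > 0" "\<epsilon> \<le> 1" using assms by (auto simp: \<epsilon>_def intro!: divide_pos_pos)
  have "4 * (b + 1) * \<epsilon> < (4 * (b + 1) + 1) * \<epsilon>" using \<epsilon> by simp
  also have "\<dots> \<le> (4 * (b + 1) + 1) * (\<eta> / (4 * (b + 1) + 1))"
    using b by (intro mult_left_mono) (auto simp: \<epsilon>_def)
  also have "\<dots> = \<eta>" using b by simp
  finally have small: "4 * (b + 1) * \<epsilon> < \<eta>" .
  have "\<bar>sq_length q {u, v} - sq_length p {u, v}\<bar> < \<eta>"
    if q: "dist (q u) (p u) < \<epsilon>" "dist (q v) (p v) < \<epsilon>" for q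
  proof -
    define a where "a = dist (q u) (q v)"
    have "a \<le> b + 2 * \<epsilon>"
      using dist_triangle[of "q u" "q v" "p u"] dist_triangle[of "p u" "q v" "p v"] q
      unfolding a_def b_def by (simp add: dist_commute)
    moreover have "b \<le> a + 2 * \<epsilon>"
      using dist_triangle[of "p u" "p v" "q u"] dist_triangle[of "q u" "p v" "q v"] q
      unfolding a_def b_def by (simp add: dist_commute)
    moreover have "0 \<le> a" by (simp add: a_def)
    ultimately have "\<bar>a - b\<bar> \<le> 2 * \<epsilon>" "\<bar>a + b\<bar> \<le> 2 * b + 2" using \<epsilon> b by auto
    then have "\<bar>a - b\<bar> * \<bar>a + b\<bar> \<le> (2 * \<epsilon>) * (2 * b + 2)"
      using \<epsilon> by (intro mult_mono) auto
    moreover have "sq_length q {u, v} - sq_length p {u, v} = (a - b) * (a + b)"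
      by (simp add: sq_length_pair a_def b_def power2_eq_square algebra_simps)
    moreover have "(2 * \<epsilon>) * (2 * b + 2) = 4 * (b + 1) * \<epsilon>" by (simp add: algebra_simps)
    ultimately show ?thesis
      using small by (simp only: abs_mult)
  qed
  then show ?thesis using \<epsilon>(1) by blast
qed

text \<open>Surjectivity of the differential of the edge length map, i.e. independence of the rows of the
  rigidity matrix.\<close>

definition independent_framework :: "'a set set \<Rightarrow> ('a \<Rightarrow> real^'n) \<Rightarrow> bool" where
  "independent_framework E p \<longleftrightarrow> (\<forall>b. \<exists>m. \<forall>e\<in>E. edge_form p m e = b e)"

lemma independent_frameworkD:
  assumes "independent_framework E p"
  obtains m where "\<And>e. e \<in> E \<Longrightarrow> edge_form p m e = b e"
  using assms unfolding independent_framework_def by blast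

text \<open>As the length map is quadratic, prescribing lengths amounts to a fixed point problem
  \<open>y = (\<beta> - sq_length (h y)) / 2\<close> with \<open>h\<close> a linear right inverse of the differential;
  near \<open>0\<close> this is a contraction.\<close>

lemma realise_nearby_lengths:
  fixes q :: "'a \<Rightarrow> real^'n"
  assumes G: "simple_graph V E" and ind: "independent_framework E q" and "\<epsilon> > 0"
  shows "\<exists>\<delta>>0. \<forall>b. (\<forall>e\<in>E. \<bar>b e - sq_length q e\<bar> < \<delta>) \<longrightarrow>
    (\<exists>q'. (\<forall>v\<in>V. dist (q' v) (q v) < \<epsilon>) \<and> (\<forall>e\<in>E. sq_length q' e = b e))"
proof -
  note fin = simple_graph_finite[OF G]
  have "\<forall>f. \<exists>m. \<forall>e\<in>E. edge_form q m e = (if e = f then 1 else 0)"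
  proof
    fix f
    show "\<exists>m. \<forall>e\<in>E. edge_form q m e = (if e = f then 1 else 0)"
      using independent_frameworkD[OF ind, of "\<lambda>e. if e = f then 1 else 0"] by metis
  qed
  then obtain m where m: "\<And>f e. e \<in> E \<Longrightarrow> edge_form q (m f) e = (if e = f then 1 else 0)"
    by metis
  define h where "h y v = (\<Sum>f\<in>E. y f *\<^sub>R m f v)" for y v
  define C where "C = (\<Sum>f\<in>E. \<Sum>v\<in>V. norm (m f v)) + 1"
  have "0 \<le> (\<Sum>f\<in>E. \<Sum>v\<in>V. norm (m f v))" by (intro sum_nonneg) auto
  then have C: "C \<ge> 1" by (simp add: C_def)
  have mC: "(\<Sum>f\<in>E. norm (m f v)) \<le> C" if "v \<in> V" for v
  proof -
    have "(\<Sum>f\<in>E. norm (m f v)) \<le> (\<Sum>f\<in>E. \<Sum>v\<in>V. norm (m f v))"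
      using that fin by (intro sum_mono member_le_sum) auto
    then show ?thesis by (simp add: C_def)
  qed
  have mC': "norm (m f v) \<le> C" if "v \<in> V" "f \<in> E" for f v
    using mC[OF that(1)] member_le_sum[of f E "\<lambda>f. norm (m f v)"] that fin by auto
  define N where "N = real (card E) + 1"
  \<comment> \<open>On the cube of radius \<open>r\<close> each squared length of \<open>h y\<close>
    has Lipschitz constant \<open>8 * C\<^sup>2 * r\<close> for the sum norm; summed over the edges
    and halved in \<open>T\<close> this leaves at most 1/2. The second bound keeps the displacement,
    at most \<open>C * r\<close>, below \<open>\<epsilon>\<close>.\<close>
  define r where "r = min (1 / (8 * C\<^sup>2 * N)) (\<epsilon> / (2 * C))"
  have N: "N \<ge> 1" by (simp add: N_def)
  have C2: "C\<^sup>2 \<ge> 1" using C by (simp add: one_le_power)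
  have r: "r > 0" using C2 C N \<open>\<epsilon> > 0\<close> by (auto simp: r_def)
  have "8 * C\<^sup>2 * N * r \<le> 8 * C\<^sup>2 * N * (1 / (8 * C\<^sup>2 * N))"
    using C2 N by (intro mult_left_mono) (auto simp: r_def)
  moreover have "8 * C\<^sup>2 * N \<noteq> 0" using C N by simp
  ultimately have r1: "8 * C\<^sup>2 * N * r \<le> 1" by simp
  have "8 * C\<^sup>2 * r * 1 \<le> 8 * C\<^sup>2 * r * N"
    by (rule mult_left_mono[OF N]) (use r in simp)
  also have "\<dots> = 8 * C\<^sup>2 * N * r" by (simp only: mult_ac)
  finally have r2: "8 * C\<^sup>2 * r \<le> 1" using r1 by linarith
  have "2 * C * r \<le> 2 * C * (\<epsilon> / (2 * C))"
    using C by (intro mult_left_mono) (auto simp: r_def)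
  then have r3: "2 * C * r \<le> \<epsilon>" using C by simp
  have hr: "norm (h y v) \<le> C * r" if "\<forall>f. \<bar>y f\<bar> \<le> r" "v \<in> V" for y v
  proof -
    have "norm (h y v) \<le> (\<Sum>f\<in>E. r * norm (m f v))"
      unfolding h_def by (rule sum_norm_le) (use that(1) in \<open>auto intro!: mult_right_mono\<close>)
    also have "\<dots> \<le> r * C"
      unfolding sum_distrib_left[symmetric] using mC that r by (intro mult_left_mono) auto
    finally show ?thesis by (simp add: mult.commute)
  qed
  have hdiff: "norm (h y v - h z v) \<le> C * (\<Sum>f\<in>E. \<bar>y f - z f\<bar>)" if "v \<in> V" for y z v
  proof -
    have "h y v - h z v = (\<Sum>f\<in>E. (y f - z f) *\<^sub>R m f v)"
      by (simp add: h_def sum_subtractf scaleR_diff_left)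
    also have "norm \<dots> \<le> (\<Sum>f\<in>E. \<bar>y f - z f\<bar> * C)"
      by (rule sum_norm_le) (auto intro!: mult_left_mono mC' that)
    finally show ?thesis by (simp add: sum_distrib_left mult.commute)
  qed
  have sq_diff: "\<bar>sq_length (h y) e - sq_length (h z) e\<bar> \<le> 8 * C\<^sup>2 * r * (\<Sum>f\<in>E. \<bar>y f - z f\<bar>)"
    if yz: "\<forall>f. \<bar>y f\<bar> \<le> r" "\<forall>f. \<bar>z f\<bar> \<le> r" and e: "e \<in> E" for y z e
  proof -
    obtain u v where uv: "u \<in> V" "v \<in> V" "e = {u, v}" using simple_graph_edge[OF G e] by blast
    define a b where "a = h y u - h y v" and "b = h z u - h z v"
    have "norm a \<le> norm (h y u) + norm (h y v)" "norm b \<le> norm (h z u) + norm (h z v)"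
      by (simp_all add: a_def b_def norm_triangle_ineq4)
    moreover have "norm (h y u) \<le> C * r" "norm (h y v) \<le> C * r" "norm (h z u) \<le> C * r" "norm (h z v) \<le> C * r"
      using hr yz uv by blast+
    ultimately have "norm a \<le> 2 * C * r" "norm b \<le> 2 * C * r" by linarith+
    then have ab1: "norm (a + b) \<le> 4 * C * r" using norm_triangle_ineq[of a b] by linarith
    have "a - b = (h y u - h z u) - (h y v - h z v)" by (simp add: a_def b_def)
    then have "norm (a - b) \<le> norm (h y u - h z u) + norm (h y v - h z v)"
      by (metis norm_triangle_ineq4)
    then have ab2: "norm (a - b) \<le> 2 * (C * (\<Sum>f\<in>E. \<bar>y f - z f\<bar>))"
      using hdiff[OF uv(1), of y z] hdiff[OF uv(2), of y z] by linarith
    have "sq_length (h y) e - sq_length (h z) e = (a + b) \<bullet> (a - b)"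
      by (simp add: uv(3) edge_form_pair a_def b_def inner_diff_left inner_diff_right
          inner_add_left inner_add_right algebra_simps inner_commute)
    then have "\<bar>sq_length (h y) e - sq_length (h z) e\<bar> \<le> norm (a + b) * norm (a - b)"
      using Cauchy_Schwarz_ineq2 by metis
    also have "\<dots> \<le> (4 * C * r) * (2 * (C * (\<Sum>f\<in>E. \<bar>y f - z f\<bar>)))"
      using ab1 ab2 C r by (intro mult_mono) auto
    finally show ?thesis by (simp add: power2_eq_square mult_ac)
  qed
  have sq_le: "\<bar>sq_length (h y) e\<bar> \<le> 4 * C\<^sup>2 * r\<^sup>2" if y: "\<forall>f. \<bar>y f\<bar> \<le> r" and e: "e \<in> E" for y e
  proof -
    obtain u v where uv: "u \<in> V" "v \<in> V" "e = {u, v}" using simple_graph_edge[OF G e] by blast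
    have "norm (h y u - h y v) \<le> 2 * C * r"
      using norm_triangle_ineq4[of "h y u" "h y v"] hr[OF y uv(1)] hr[OF y uv(2)] by linarith
    then have "(norm (h y u - h y v))\<^sup>2 \<le> (2 * C * r)\<^sup>2" by (rule power_mono) simp
    then show ?thesis
      by (simp add: uv(3) edge_form_pair power2_norm_eq_inner[symmetric] power_mult_distrib)
  qed
  \<comment> \<open>The radius \<open>r\<close> also serves as \<open>\<delta>\<close>: with length
    errors below \<open>r\<close> and a quadratic term of at most \<open>r / 2\<close>,
    \<open>T\<close> maps the cube into itself.\<close>
  have "\<exists>q'. (\<forall>v\<in>V. dist (q' v) (q v) < \<epsilon>) \<and> (\<forall>e\<in>E. sq_length q' e = b e)"
    if b: "\<forall>e\<in>E. \<bar>b e - sq_length q e\<bar> < r" for b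
  proof -
    define T where "T y e = ((b e - sq_length q e) - sq_length (h y) e) / 2" for y e
    have "\<exists>y. (\<forall>f. \<bar>y f\<bar> \<le> r) \<and> (\<forall>e\<in>E. T y e = y e)"
    proof (rule contraction_fixed_point[OF fin(2)])
      show "0 \<le> r" using r by simp
      show "continuous_on UNIV (\<lambda>y. T y e)" if e: "e \<in> E" for e
      proof -
        obtain u v where "e = {u, v}" using simple_graph_edge[OF G e] by blast
        then show ?thesis
          unfolding T_def h_def by (simp only: edge_form_pair)
            (intro continuous_intros continuous_on_product_coordinates, simp_all)
      qed
      show "\<bar>T y e\<bar> \<le> r" if y: "\<forall>f. \<bar>y f\<bar> \<le> r" and e: "e \<in> E" for y e
      proof -
        have "4 * C\<^sup>2 * r\<^sup>2 = (8 * C\<^sup>2 * r) * r / 2" by (simp add: power2_eq_square)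
        also have "\<dots> \<le> 1 * r / 2" using r r2 by (intro divide_right_mono mult_right_mono) auto
        finally have "\<bar>sq_length (h y) e\<bar> \<le> r / 2" using sq_le[OF y e] by linarith
        moreover have "\<bar>b e - sq_length q e\<bar> < r" using b e by blast
        moreover have "\<bar>(a - s) / 2\<bar> \<le> r" if "\<bar>s\<bar> \<le> r / 2" "\<bar>a\<bar> < r" for a s :: real
          using that by (auto simp: abs_le_iff abs_less_iff)
        ultimately show ?thesis unfolding T_def by blast
      qed
      show "(\<Sum>e\<in>E. \<bar>T y e - T z e\<bar>) \<le> (\<Sum>e\<in>E. \<bar>y e - z e\<bar>) / 2"
        if yz: "\<forall>f. \<bar>y f\<bar> \<le> r" "\<forall>f. \<bar>z f\<bar> \<le> r" for y z
      proof -
        let ?S = "\<Sum>f\<in>E. \<bar>y f - z f\<bar>"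
        have "(\<Sum>e\<in>E. \<bar>T y e - T z e\<bar>) \<le> (\<Sum>e\<in>E. 8 * C\<^sup>2 * r * ?S / 2)"
        proof (rule sum_mono)
          fix e assume e: "e \<in> E"
          have "T y e - T z e = - ((sq_length (h y) e - sq_length (h z) e) / 2)"
            unfolding T_def by (simp add: field_simps)
          then have "\<bar>T y e - T z e\<bar> = \<bar>sq_length (h y) e - sq_length (h z) e\<bar> / 2" by simp
          then show "\<bar>T y e - T z e\<bar> \<le> 8 * C\<^sup>2 * r * ?S / 2"
            using divide_right_mono[OF sq_diff[OF yz e], of 2] by (simp only: zero_le_numeral)
        qed
        also have "\<dots> = (8 * C\<^sup>2 * real (card E) * r) * ?S / 2" by simp
        also have "\<dots> \<le> 1 * ?S / 2"
        proof (intro divide_right_mono mult_right_mono)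
          have "8 * C\<^sup>2 * real (card E) * r \<le> 8 * C\<^sup>2 * N * r"
            using r C2 by (intro mult_right_mono mult_left_mono) (auto simp: N_def)
          then show "8 * C\<^sup>2 * real (card E) * r \<le> 1" using r1 by simp
        qed (auto intro: sum_nonneg)
        finally show ?thesis by simp
      qed
    qed
    then obtain y where y: "\<forall>f. \<bar>y f\<bar> \<le> r" "\<And>e. e \<in> E \<Longrightarrow> T y e = y e" by blast
    define q' where "q' v = q v + h y v" for v
    have "dist (q' v) (q v) < \<epsilon>" if "v \<in> V" for v
    proof -
      have "0 < C * r" using C r by simp
      then show ?thesis using hr[OF y(1) that] r3 by (simp add: q'_def dist_norm)
    qed
    moreover have "sq_length q' e = b e" if e: "e \<in> E" for e
    proof -
      obtain u v where uv: "e = {u, v}" using simple_graph_edge[OF G e] by blast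
      have "edge_form q (h y) e = (\<Sum>f\<in>E. y f * edge_form q (m f) e)"
        unfolding h_def by (rule edge_form_sum[OF fin(2)])
      also have "\<dots> = y e"
        using e fin by (simp add: m if_distrib[of "\<lambda>t. _ * t"] cong: if_cong)
      finally have "edge_form q (h y) e = y e" .
      moreover have "sq_length q' e = sq_length q e + 2 * edge_form q (h y) e + sq_length (h y) e"
        by (simp add: uv edge_form_pair q'_def inner_diff_left inner_diff_right
          inner_add_left inner_add_right algebra_simps inner_commute)
      ultimately show ?thesis using y(2)[OF e] by (simp add: T_def field_simps)
    qed
    ultimately show ?thesis by blast
  qed
  then show ?thesis using r by blast
qed

section \<open>Generic and rigid frameworks\<close>

definition coord :: "'a \<times> 'n \<Rightarrow> ('a \<Rightarrow> real^'n) \<Rightarrow> real" where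
  "coord vi p = p (fst vi) $ snd vi"

lemma generic_polynomial_function:
  fixes p :: "'a \<Rightarrow> real^'n"
  assumes "finite V" "generic V p" "f \<in> ring_hull (coord ` (V \<times> UNIV))" "f p = 0"
  shows "f = 0"
proof -
  define flat where "flat p = (\<lambda>(v, i). p v $ i)" for p :: "'a \<Rightarrow> real^'n"
  let ?X = "\<lambda>i (y :: 'a \<times> 'n \<Rightarrow> real). y i"
  have "coord ` (V \<times> UNIV) = (\<lambda>g. g \<circ> flat) ` ?X ` (V \<times> UNIV)"
    unfolding image_image by (rule image_cong) (auto simp: coord_def flat_def)
  moreover have "ring_hull ((\<lambda>g. g \<circ> flat) ` S) = (\<lambda>g. g \<circ> flat) ` ring_hull S"
    for S :: "(('a \<times> 'n \<Rightarrow> real) \<Rightarrow> real) set"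
    by (rule ring_hull_image) (auto simp: fun_eq_iff)
  ultimately obtain g where g: "g \<in> ring_hull (?X ` (V \<times> UNIV))" "f = g \<circ> flat"
    using assms(3) by auto
  have "g = 0"
  proof (rule alg_indep_Q_polynomial_function[OF _ _ g(1)])
    show "alg_indep_Q (V \<times> UNIV) (flat p)" using assms(2) by (simp add: generic_def flat_def)
    show "g (flat p) = 0" using assms(4) g(2) by simp
  qed (use assms(1) in simp)
  then show ?thesis using g(2) by (simp add: fun_eq_iff)
qed

definition deriv_at :: "(real \<Rightarrow> real) \<Rightarrow> ('a \<Rightarrow> real^'n) \<Rightarrow> 'a \<Rightarrow> real^'n" where
  "deriv_at D p v = (\<chi> i. D (p v $ i))"

lemma generic_derivation:
  fixes p :: "'a \<Rightarrow> real^'n"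
  assumes "finite V" "generic V p"
  obtains D where "derivation D" "\<And>v. v \<in> V \<Longrightarrow> deriv_at D p v = m v"
proof -
  have "free_family (V \<times> UNIV) (\<lambda>(v, i). p v $ i)"
    using assms by (intro alg_indep_Q_free) (auto simp: generic_def)
  then obtain D where "derivation D"
      "\<And>i. i \<in> V \<times> UNIV \<Longrightarrow> D (case i of (v, i) \<Rightarrow> p v $ i) = (case i of (v, i) \<Rightarrow> m v $ i)"
    using free_familyD[where v = "\<lambda>(v, i). m v $ i"] by blast
  then show thesis
    by (intro that[of D]) (fastforce simp: deriv_at_def vec_eq_iff)+
qed

lemma derivation_inner:
  assumes "derivation D"
  shows "D (a \<bullet> b) = a \<bullet> (\<chi> i. D (b $ i)) + (\<chi> i. D (a $ i)) \<bullet> b"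
  using assms by (simp add: inner_vec_def derivation_sum derivation_mult sum.distrib)

text \<open>By the product rule \<open>deriv_at D p\<close> acts as a velocity field at
  \<open>p\<close>. At generic frameworks every velocity field arises in this way, by
  \<open>generic_derivation\<close>.\<close>

lemma derivation_sq_length:
  assumes "derivation D"
  shows "D (sq_length p {u, v}) = 2 * edge_form p (deriv_at D p) {u, v}"
proof -
  have "(\<chi> i. D ((p u - p v) $ i)) = deriv_at D p u - deriv_at D p v"
    using assms by (simp add: vec_eq_iff deriv_at_def derivation_diff)
  then show ?thesis
    unfolding edge_form_pair derivation_inner[OF assms] by (simp add: inner_commute)
qed

lemma derivation_sq_length_edge:
  assumes "simple_graph V E" "e \<in> E" "derivation D"
  shows "D (sq_length p e) = 2 * edge_form p (deriv_at D p) e"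
  by (rule simple_graph_edge[OF assms(1,2)]) (simp add: derivation_sq_length[OF assms(3)])

lemma edge_form_cong:
  assumes "simple_graph V E" "e \<in> E" "\<And>v. v \<in> V \<Longrightarrow> p v = p' v" "\<And>v. v \<in> V \<Longrightarrow> m v = m' v"
  shows "edge_form p m e = edge_form p' m' e"
  by (rule simple_graph_edge[OF assms(1,2)]) (simp add: edge_form_pair assms(3,4))

lemma sq_length_polynomial:
  assumes "u \<in> V" "v \<in> V"
  shows "(\<lambda>p. sq_length p {u, v}) \<in> ring_hull (coord ` (V \<times> UNIV))"
proof -
  have "(\<lambda>p :: 'a \<Rightarrow> real^'n. sq_length p {u, v})
      = (\<Sum>i\<in>UNIV. (coord (u, i) - coord (v, i)) * (coord (u, i) - coord (v, i)))"
    by (rule ext) (simp add: edge_form_pair inner_vec_def sum_fun_apply coord_def)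
  also have "\<dots> \<in> ring_hull (coord ` (V \<times> UNIV))"
    using assms by (intro ring_hull_sum ring_hull.mult ring_hull.diff ring_hull.gen) auto
  finally show ?thesis .
qed

lemma sq_length_edge_polynomial:
  assumes "simple_graph V E" "e \<in> E"
  shows "(\<lambda>p. sq_length p e) \<in> ring_hull (coord ` (V \<times> UNIV))"
  by (rule simple_graph_edge[OF assms]) (simp add: sq_length_polynomial)

section \<open>Independence of edge lengths and rigidity\<close>

text \<open>At a generic \<open>p\<close> velocity fields come from derivations, so a surjective
  differential allows arbitrary values of \<open>D\<close> on the lengths.\<close>

lemma independent_framework_free:
  assumes G: "simple_graph V E" and "generic V p" "independent_framework E p"
  shows "free_family E (sq_length p)"
  unfolding free_family_def
proof
  fix b :: "'a set \<Rightarrow> real"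
  obtain m where m: "\<And>e. e \<in> E \<Longrightarrow> edge_form p m e = b e / 2"
    using independent_frameworkD[OF assms(3), of "\<lambda>e. b e / 2"] by blast
  obtain D where D: "derivation D" "\<And>v. v \<in> V \<Longrightarrow> deriv_at D p v = m v"
    using generic_derivation simple_graph_finite(1)[OF G] assms(2) by blast
  have "D (sq_length p e) = b e" if "e \<in> E" for e
  proof -
    have "edge_form p (deriv_at D p) e = edge_form p m e"
      by (rule edge_form_cong[OF G that]) (auto simp: D(2))
    then show ?thesis
      using derivation_sq_length_edge[OF G that D(1), of p] m[OF that] by simp
  qed
  then show "\<exists>D. derivation D \<and> (\<forall>e\<in>E. D (sq_length p e) = b e)" using D(1) by blast
qed

text \<open>The converse reads the velocity field off the derivation and so works at every
  framework, in particular at \<open>q\<close>.\<close>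

lemma free_independent_framework:
  assumes G: "simple_graph V E" and "free_family E (sq_length p)"
  shows "independent_framework E p"
  unfolding independent_framework_def
proof
  fix b :: "'a set \<Rightarrow> real"
  obtain D where D: "derivation D" "\<And>e. e \<in> E \<Longrightarrow> D (sq_length p e) = 2 * b e"
    using free_familyD[OF assms(2), where v = "\<lambda>e. 2 * b e"] by blast
  have "edge_form p (deriv_at D p) e = b e" if "e \<in> E" for e
    using derivation_sq_length_edge[OF G that D(1), of p] D(2)[OF that] by simp
  then show "\<exists>m. \<forall>e\<in>E. edge_form p m e = b e" by blast
qed

text \<open>Rigidity provides some generic framework, while the count ranges over all of them.
  Independence of the lengths is a property of the length polynomials, hence the same at all generic
  points.\<close>

lemma generic_free_lengths_transfer:
  fixes p p' :: "'a \<Rightarrow> real^'n"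
  assumes G: "simple_graph V E" and "generic V p" "generic V p'" "free_family E (sq_length p)"
  shows "free_family E (sq_length p')"
proof (rule free_familyI)
  note fin = simple_graph_finite[OF G]
  show "finite E" by (rule fin)
  fix e assume e: "e \<in> E"
  let ?g = "\<lambda>e (p :: 'a \<Rightarrow> real^'n). sq_length p e"
  have eq: "sq_length p ` (E - {e}) = (\<lambda>f. f p) ` ?g ` (E - {e})" for p
    by (simp add: image_image)
  show "\<not> algebraic_over (ring_hull (sq_length p' ` (E - {e}))) (sq_length p' e)"
  proof
    assume *: "algebraic_over (ring_hull (sq_length p' ` (E - {e}))) (sq_length p' e)"
    have "?g ` (E - {e}) \<subseteq> ring_hull (coord ` (V \<times> UNIV))" "?g e \<in> ring_hull (coord ` (V \<times> UNIV))"
      using sq_length_edge_polynomial[OF G] e by blast+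
    from algebraic_transfer[where g = "?g e", OF generic_polynomial_function[OF fin(1) assms(3)]
        generic_polynomial_function[OF fin(1) assms(2)] this *[unfolded eq]]
    have "algebraic_over (ring_hull (sq_length p ` (E - {e}))) (sq_length p e)"
      unfolding eq by simp
    then show False using free_family_transcendental[OF assms(4) e] by simp
  qed
qed

text \<open>A dependent edge is redundant. A stress that is nonzero on \<open>e\<close> rules out a
  derivation moving the length of \<open>e\<close> alone, so this length is algebraic over the
  others. Keeping the other lengths then leaves finitely many values for it, and near
  \<open>p\<close> it cannot change by continuity, so \<open>E - {e}\<close> would be rigid.\<close>

lemma minimally_rigid_independent:
  fixes p :: "'a \<Rightarrow> real^'n"
  assumes G: "simple_graph V E" and gen: "generic V p" and rigid: "rigid_framework V E p"
    and minimal: "\<And>e. e \<in> E \<Longrightarrow> \<not> rigid_framework V (E - {e}) p"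
  shows "independent_framework E p"
  unfolding independent_framework_def
proof (rule allI, rule functionals_dependent_or_surjective)
  note fin = simple_graph_finite[OF G]
  show "finite E" by (rule fin)
  show "edge_form p (\<lambda>v. m v + c *\<^sub>R m' v) e = edge_form p m e + c * edge_form p m' e" for e m m' c
    by (rule edge_form_linear)
  fix w assume stress: "\<And>m. (\<Sum>e\<in>E. w e * edge_form p m e) = 0"
  show "\<forall>e\<in>E. w e = 0"
  proof (rule ccontr)
    assume "\<not> (\<forall>e\<in>E. w e = 0)"
    then obtain e where e: "e \<in> E" "w e \<noteq> 0" by blast
    obtain u v where uv: "u \<in> V" "v \<in> V" "e = {u, v}" using simple_graph_edge[OF G e(1)] by blast
    let ?E = "E - {e}" and ?g = "\<lambda>e (p :: 'a \<Rightarrow> real^'n). sq_length p e"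
    have eq: "sq_length p ` ?E = (\<lambda>f. f p) ` ?g ` ?E"
      by (simp add: image_image)
    have "algebraic_over (ring_hull (sq_length p ` ?E)) (sq_length p e)"
    proof (rule ccontr)
      assume "\<not> ?thesis"
      then obtain D where D: "derivation D" "\<forall>b\<in>sq_length p ` ?E. D b = 0" "D (sq_length p e) = 1"
        using transcendental_derivation by blast
      have "edge_form p (deriv_at D p) f = (if f = e then 1 / 2 else 0)" if "f \<in> E" for f
        using derivation_sq_length_edge[OF G that D(1), of p] D(2,3) that by (cases "f = e") auto
      then have "(\<Sum>f\<in>E. w f * edge_form p (deriv_at D p) f) = (\<Sum>f\<in>E. if f = e then w f / 2 else 0)"
        by (intro sum.cong) auto
      then show False using stress[of "deriv_at D p"] fin e by simp
    qed
    then have alg: "algebraic_over (ring_hull ((\<lambda>f. f p) ` ?g ` ?E)) (?g e p)"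
      unfolding eq .
    have "?g ` ?E \<subseteq> ring_hull (coord ` (V \<times> UNIV))" "?g e \<in> ring_hull (coord ` (V \<times> UNIV))"
      using sq_length_edge_polynomial[OF G] e(1) by blast+
    from polynomial_relation[OF generic_polynomial_function[OF fin(1) gen] this alg]
    obtain h N where h: "\<And>k. h k \<in> ring_hull (?g ` ?E)" "\<exists>k\<le>N. h k p \<noteq> 0"
        "\<And>q. (\<Sum>k\<le>N. h k q * sq_length q e ^ k) = 0"
      by auto
    define P where "P = (\<Sum>k\<le>N. monom (h k p) k)"
    have "coeff P k = (if k \<le> N then h k p else 0)" for k
      by (simp add: P_def coeff_sum)
    then have "P \<noteq> 0" using h(2) by (metis coeff_0)
    then have "finite {t. poly P t = 0}" by (rule poly_roots_finite)
    then obtain \<eta> where \<eta>: "\<eta> > 0" "\<forall>t\<in>{t. poly P t = 0}. t \<noteq> sq_length p e \<longrightarrow> \<eta> \<le> dist (sq_length p e) t"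
      using finite_set_avoid by blast
    obtain \<epsilon>1 where \<epsilon>1: "\<epsilon>1 > 0"
        "\<And>q. (\<forall>v\<in>V. dist (q v) (p v) < \<epsilon>1) \<Longrightarrow> equivalent_real E p q \<Longrightarrow> congruent_real V p q"
      using rigid unfolding rigid_framework_def by blast
    obtain \<epsilon>2 where \<epsilon>2: "\<epsilon>2 > 0"
        "\<And>q. dist (q u) (p u) < \<epsilon>2 \<Longrightarrow> dist (q v) (p v) < \<epsilon>2 \<Longrightarrow> \<bar>sq_length q e - sq_length p e\<bar> < \<eta>"
      using sq_length_continuous[OF \<eta>(1), of u p v] uv(3) by blast
    have G': "simple_graph V ?E" using G by (auto simp: simple_graph_def)
    have "rigid_framework V ?E p"
      unfolding rigid_framework_def
    proof (intro exI conjI allI impI)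
      show "min \<epsilon>1 \<epsilon>2 > 0" using \<epsilon>1 \<epsilon>2 by simp
      fix q assume "(\<forall>v\<in>V. dist (q v) (p v) < min \<epsilon>1 \<epsilon>2) \<and> equivalent_real ?E p q"
      then have near: "\<And>v. v \<in> V \<Longrightarrow> dist (q v) (p v) < \<epsilon>1 \<and> dist (q v) (p v) < \<epsilon>2"
        and eqv: "\<And>f. f \<in> ?E \<Longrightarrow> sq_length p f = sq_length q f"
        by (auto simp: equivalent_real_iff_sq_length[OF G'])
      \<comment> \<open>The coefficients of the relation are polynomials in the lengths of
        \<open>?E\<close> only, so \<open>P\<close> is the same for \<open>q\<close> as for
        \<open>p\<close>.\<close>
      have "h k q = h k p" for k
      proof (rule ring_hull_fun_cong[OF h(1)])
        fix f assume "f \<in> ?g ` ?E"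
        then obtain e' where "e' \<in> ?E" "f = ?g e'" by blast
        then show "f q = f p" using eqv by simp
      qed
      then have "poly P (sq_length q e) = 0"
        using h(3)[of q] by (simp add: P_def poly_sum poly_monom)
      moreover have "\<bar>sq_length q e - sq_length p e\<bar> < \<eta>" using \<epsilon>2(2) near uv by blast
      ultimately have "sq_length q e = sq_length p e"
        using \<eta>(2) by (fastforce simp: dist_real_def abs_minus_commute)
      then have "equivalent_real E p q"
        using eqv unfolding equivalent_real_iff_sq_length[OF G] by (metis DiffI singletonD)
      then show "congruent_real V p q" using \<epsilon>1(2) near by blast
    qed
    then show False using minimal e(1) by blast
  qed
qed

text \<open>Infinitesimal rigidity in terms of derivations. A \<open>D\<close> that kills all edge
  lengths but not that of \<open>{u, v}\<close> would make \<open>E\<close> independent together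
  with \<open>{u, v}\<close>; then the distance of \<open>u\<close> and \<open>v\<close> could be
  changed arbitrarily close to \<open>p\<close> with all edge lengths kept.\<close>

lemma rigid_derivation_sq_length:
  fixes p :: "'a \<Rightarrow> real^'n"
  assumes G: "simple_graph V E" and rigid: "rigid_framework V E p"
    and ind: "independent_framework E p" and D: "derivation D" "\<And>e. e \<in> E \<Longrightarrow> D (sq_length p e) = 0"
    and uv: "u \<in> V" "v \<in> V"
  shows "D (sq_length p {u, v}) = 0"
proof (rule ccontr)
  assume nz: "D (sq_length p {u, v}) \<noteq> 0"
  let ?e = "{u, v}" and ?E = "insert {u, v} E"
  have "?e \<notin> E" using D(2) nz by blast
  have "u \<noteq> v" using nz D(1) by (auto simp: edge_form_pair derivation_zero)
  then have G': "simple_graph V ?E" using G uv by (auto simp: simple_graph_def)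
  have "independent_framework ?E p"
    unfolding independent_framework_def
  proof
    fix b :: "'a set \<Rightarrow> real"
    obtain m where m: "\<And>e. e \<in> E \<Longrightarrow> edge_form p m e = b e"
      using ind unfolding independent_framework_def by blast
    have D0: "edge_form p (deriv_at D p) e = 0" if "e \<in> E" for e
      using derivation_sq_length_edge[OF G that D(1), of p] D(2)[OF that] by simp
    have Dn: "edge_form p (deriv_at D p) ?e \<noteq> 0"
      using derivation_sq_length[OF D(1), of p u v] nz by simp
    define c where "c = (b ?e - edge_form p m ?e) / edge_form p (deriv_at D p) ?e"
    have "\<forall>e\<in>?E. edge_form p (\<lambda>v. m v + c *\<^sub>R deriv_at D p v) e = b e"
      unfolding edge_form_linear using m D0 Dn by (auto simp: c_def)
    then show "\<exists>m. \<forall>e\<in>?E. edge_form p m e = b e" by blast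
  qed
  moreover obtain \<epsilon> where \<epsilon>: "\<epsilon> > 0"
      "\<And>q. (\<forall>v\<in>V. dist (q v) (p v) < \<epsilon>) \<Longrightarrow> equivalent_real E p q \<Longrightarrow> congruent_real V p q"
    using rigid unfolding rigid_framework_def by blast
  ultimately obtain \<delta> where \<delta>: "\<delta> > 0" "\<And>b. (\<forall>e\<in>?E. \<bar>b e - sq_length p e\<bar> < \<delta>) \<Longrightarrow>
      (\<exists>q. (\<forall>v\<in>V. dist (q v) (p v) < \<epsilon>) \<and> (\<forall>e\<in>?E. sq_length q e = b e))"
    using realise_nearby_lengths[OF G'] by blast
  define b where "b e = sq_length p e + (if e = ?e then \<delta> / 2 else 0)" for e
  have "\<forall>e\<in>?E. \<bar>b e - sq_length p e\<bar> < \<delta>" using \<delta>(1) by (auto simp: b_def)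
  then obtain q where q: "\<forall>v\<in>V. dist (q v) (p v) < \<epsilon>" "\<forall>e\<in>?E. sq_length q e = b e"
    using \<delta>(2) by blast
  have "equivalent_real E p q"
    unfolding equivalent_real_iff_sq_length[OF G] using q(2) \<open>?e \<notin> E\<close> by (auto simp: b_def)
  then have "congruent_real V p q" using \<epsilon>(2) q(1) by blast
  then have "sq_length q ?e = sq_length p ?e"
    using uv by (auto simp: congruent_real_def sq_length_pair)
  moreover have "sq_length q ?e = sq_length p ?e + \<delta> / 2" using q(2) by (simp add: b_def)
  ultimately show False using \<delta>(1) by simp
qed

section \<open>Counting pinned coordinates\<close>

text \<open>With as many vectors as dimensions, a trivial orthogonal complement means a basis; it is
  also the kernel condition for the matrix with rows \<open>u i\<close>.\<close>

definition spanning :: "('n \<Rightarrow> real^'n) \<Rightarrow> bool" where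
  "spanning u \<longleftrightarrow> (\<forall>y. (\<forall>i. u i \<bullet> y = 0) \<longrightarrow> y = 0)"

lemma spanning_iff_left_invertible:
  "spanning u \<longleftrightarrow> (\<exists>B. B ** (\<chi> i. u i) = mat 1)"
  unfolding matrix_left_invertible_ker spanning_def
  by (simp add: vec_eq_iff matrix_vector_mul_component)

lemma spanning_solve:
  assumes "spanning u"
  obtains y where "\<And>i. u i \<bullet> y = s i"
proof -
  obtain B where "(\<chi> i. u i) ** B = mat 1"
    using assms unfolding spanning_iff_left_invertible matrix_left_right_inverse by blast
  then have "(\<chi> i. u i) *v (B *v (\<chi> i. s i)) = (\<chi> i. s i)"
    by (simp add: matrix_vector_mul_assoc)
  then have "u i \<bullet> (B *v (\<chi> i. s i)) = s i" for i
    by (metis matrix_vector_mul_component vec_lambda_beta)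
  then show thesis using that by blast
qed

lemma not_spanning_dependent:
  assumes "\<not> spanning u"
  shows "\<exists>c. (\<exists>i. c i \<noteq> 0) \<and> (\<Sum>i\<in>UNIV. c i *\<^sub>R u i) = 0"
proof -
  have "\<not> (\<exists>B. (\<chi> i. u i) ** B = mat 1)"
    using assms unfolding spanning_iff_left_invertible matrix_left_right_inverse .
  then show ?thesis
    unfolding matrix_right_invertible_independent_rows
    by (auto simp: row_def scalar_mult_eq_scaleR)
qed

text \<open>Suppose the \<open>u i\<close> satisfy a relation with coefficients \<open>c i\<close>
  and \<open>y\<close> is orthogonal to all of them. Give \<open>p (w i)\<close> the velocity
  \<open>c i *\<^sub>R y\<close>, keep \<open>p x\<close> fixed, differentiate the relation and pair
  it with \<open>y\<close>: the terms with \<open>D (c i)\<close> drop out and the sum of the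
  squares of the \<open>c i\<close> would be 0.\<close>

lemma generic_spanning:
  fixes p :: "'a \<Rightarrow> real^'n" and w :: "'n \<Rightarrow> 'a"
  assumes "finite V" "generic V p" "x \<in> V" "inj w" "range w \<subseteq> V - {x}"
  shows "spanning (\<lambda>i. p (w i) - p x)"
proof (rule ccontr)
  assume ns: "\<not> ?thesis"
  define u where "u i = p (w i) - p x" for i
  obtain y where y: "y \<noteq> 0" "\<And>i. u i \<bullet> y = 0"
    using ns unfolding spanning_def u_def by blast
  obtain c k where c: "c k \<noteq> 0" "(\<Sum>i\<in>UNIV. c i *\<^sub>R u i) = 0"
    using not_spanning_dependent[OF ns] unfolding u_def by blast
  define m where "m v = (if v \<in> range w then c (inv w v) *\<^sub>R y else 0)" for v
  obtain D where D: "derivation D" "\<And>v. v \<in> V \<Longrightarrow> deriv_at D p v = m v"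
    using generic_derivation[OF assms(1,2)] by blast
  have Du: "(\<chi> l. D (u i $ l)) = c i *\<^sub>R y" for i
  proof -
    have "(\<chi> l. D (u i $ l)) = deriv_at D p (w i) - deriv_at D p x"
      using D(1) by (simp add: u_def deriv_at_def vec_eq_iff derivation_diff)
    moreover have "x \<notin> range w" "w i \<in> V" using assms(5) by blast+
    ultimately show ?thesis
      using D(2) assms(3,4) by (simp add: m_def)
  qed
  have "(\<Sum>i\<in>UNIV. c i *\<^sub>R (\<chi> l. D (u i $ l)) + D (c i) *\<^sub>R u i) = 0"
  proof -
    have "(\<Sum>i\<in>UNIV. c i * D (u i $ l) + D (c i) * u i $ l) = D ((\<Sum>i\<in>UNIV. c i *\<^sub>R u i) $ l)" for l
      using D(1) by (simp add: derivation_sum derivation_mult)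
    then show ?thesis
      using c(2) D(1) by (simp add: vec_eq_iff derivation_zero)
  qed
  then have "(\<Sum>i\<in>UNIV. (c i * c i) *\<^sub>R y + D (c i) *\<^sub>R u i) \<bullet> y = 0"
    by (simp add: Du)
  then have "(\<Sum>i\<in>UNIV. c i * c i * (y \<bullet> y)) = 0"
    by (simp add: inner_sum_left inner_add_left y(2))
  then have "(\<Sum>i\<in>UNIV. c i * c i) = 0"
    using y(1) by (simp add: sum_distrib_right[symmetric])
  then show False
    using c(1) by (simp add: sum_nonneg_eq_0_iff)
qed

text \<open>The indices of those coordinates that can be nonzero when \<open>x\<close> is placed at the origin and
  \<open>w i\<close> in the span of the basis vectors of index at most \<open>i\<close> (with respect to \<open>\<rho>\<close>).
  Up to isometries every framework has this form.\<close>

definition pinned_coords :: "'a set \<Rightarrow> 'a \<Rightarrow> ('n \<Rightarrow> 'a) \<Rightarrow> ('n \<Rightarrow> nat) \<Rightarrow> ('a \<times> 'n) set" where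
  "pinned_coords V x w \<rho> = {(v, i). v \<in> V - {x} \<and> (\<forall>j. v = w j \<longrightarrow> \<rho> i \<le> \<rho> j)}"

lemma finite_pinned_coords: "finite V \<Longrightarrow> finite (pinned_coords V x w \<rho>)"
  for w :: "'n::finite \<Rightarrow> 'a"
  by (rule finite_subset[of _ "V \<times> UNIV"]) (auto simp: pinned_coords_def)

text \<open>The inner products of \<open>p v - p x\<close> with \<open>p (w i) - p x\<close> are independent, and
  algebraic over the edge lengths by rigidity.\<close>

lemma card_pinned_coords_le:
  fixes p :: "'a \<Rightarrow> real^'n" and w :: "'n \<Rightarrow> 'a"
  assumes G: "simple_graph V E" and gen: "generic V p" and rigid: "rigid_framework V E p"
    and ind: "independent_framework E p" and x: "x \<in> V" and w: "inj w" "range w \<subseteq> V - {x}"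
    and \<rho>: "inj \<rho>"
  shows "card (pinned_coords V x w \<rho>) \<le> card E"
proof -
  note fin = simple_graph_finite[OF G]
  define u where "u v = p v - p x" for v
  define a where "a = (\<lambda>(v, i). u v \<bullet> u (w i))"
  have span: "spanning (\<lambda>i. u (w i))"
    using generic_spanning[OF fin(1) gen x w] by (simp add: u_def)
  have wV: "w i \<in> V" "w i \<noteq> x" for i using w(2) by blast+
  show ?thesis
  proof (rule free_family_card_le[OF finite_pinned_coords[OF fin(1)] fin(2)])
    show "free_family (pinned_coords V x w \<rho>) a"
      unfolding free_family_def
    proof
      fix s :: "'a \<times> 'n \<Rightarrow> real"
      \<comment> \<open>The product rule gives
        \<open>D (u (w j) \<bullet> u (w i)) = \<sigma> i j + \<sigma> j i\<close>. Of two distinct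
        indices only one order is a pinned coordinate, so its prescribed value is shared equally and
        \<open>\<sigma>\<close> is symmetric.\<close>
      define \<sigma> where "\<sigma> j i = (if \<rho> i \<le> \<rho> j then s (w j, i) else s (w i, j)) / 2" for i j
      have "\<forall>j. \<exists>y. \<forall>i. u (w i) \<bullet> y = \<sigma> j i"
        using spanning_solve[OF span] by metis
      then obtain mw where mw: "\<And>i j. u (w i) \<bullet> mw j = \<sigma> j i" by metis
      have "\<forall>v. \<exists>y. \<forall>i. u (w i) \<bullet> y = s (v, i) - u v \<bullet> mw i"
      proof
        fix v
        show "\<exists>y. \<forall>i. u (w i) \<bullet> y = s (v, i) - u v \<bullet> mw i"
          by (rule spanning_solve[OF span, of "\<lambda>i. s (v, i) - u v \<bullet> mw i"]) blast
      qed
      then obtain mv where mv: "\<And>i v. u (w i) \<bullet> mv v = s (v, i) - u v \<bullet> mw i" by metis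
      define m where "m v = (if v = x then 0 else if v \<in> range w then mw (inv w v) else mv v)" for v
      have m: "m x = 0" "m (w i) = mw i" for i
        using wV w(1) by (auto simp: m_def)
      obtain D where D: "derivation D" "\<And>v. v \<in> V \<Longrightarrow> deriv_at D p v = m v"
        using generic_derivation[OF fin(1) gen] by blast
      have Du: "(\<chi> l. D (u v $ l)) = m v" if "v \<in> V" for v
      proof -
        have "(\<chi> l. D (u v $ l)) = deriv_at D p v - deriv_at D p x"
          using D(1) by (simp add: u_def deriv_at_def vec_eq_iff derivation_diff)
        then show ?thesis using D(2) that x m(1) by simp
      qed
      have "D (a (v, i)) = s (v, i)" if vi: "(v, i) \<in> pinned_coords V x w \<rho>" for v i
      proof -
        have v: "v \<in> V" "v \<noteq> x" and le: "\<And>j. v = w j \<Longrightarrow> \<rho> i \<le> \<rho> j"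
          using vi by (auto simp: pinned_coords_def)
        have "D (a (v, i)) = u v \<bullet> mw i + m v \<bullet> u (w i)"
          using derivation_inner[OF D(1), of "u v" "u (w i)"] Du v(1) wV m(2) by (simp add: a_def)
        also have "\<dots> = s (v, i)"
        proof (cases "v \<in> range w")
          case True
          then obtain j where j: "v = w j" by blast
          have "\<sigma> i j + \<sigma> j i = s (w j, i)"
            using le[OF j] \<rho> by (cases "i = j") (auto simp: \<sigma>_def dest: injD)
          then show ?thesis
            using m(2) mw by (simp add: j inner_commute)
        next
          case False
          then have "m v = mv v" using v by (simp add: m_def)
          then show ?thesis using mv by (simp add: inner_commute)
        qed
        finally show ?thesis .
      qed
      then show "\<exists>D. derivation D \<and> (\<forall>i\<in>pinned_coords V x w \<rho>. D (a i) = s i)"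
        using D(1) by auto
    qed
  next
    fix D vi assume D: "derivation D" "\<forall>e\<in>E. D (sq_length p e) = 0"
      and vi: "vi \<in> pinned_coords V x w \<rho>"
    obtain v i where [simp]: "vi = (v, i)" by (cases vi)
    have v: "v \<in> V" using vi by (simp add: pinned_coords_def)
    have D0: "D (sq_length p {v, v'}) = 0" if "v \<in> V" "v' \<in> V" for v v'
      by (rule rigid_derivation_sq_length[OF G rigid ind D(1) _ that]) (use D(2) in blast)
    \<comment> \<open>Polarisation: twice the inner product is a combination of three squared
      distances, each killed by \<open>D\<close> because of rigidity.\<close>
    have "a vi + a vi = sq_length p {v, x} + sq_length p {w i, x} - sq_length p {v, w i}"
      by (simp add: a_def u_def edge_form_pair inner_diff_left inner_diff_right inner_commute)
    then have "D (a vi + a vi) = 0"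
      using D(1) D0 v x wV by (simp add: derivation_add derivation_diff)
    then show "D (a vi) = 0" using derivation_add[OF D(1), of "a vi" "a vi"] by linarith
  qed
qed

section \<open>Triangular normal form of a framework\<close>

text \<open>As \<open>u\<close> may be dependent, the frame is built from the top index down rather
  than by orthogonalising \<open>u\<close>: \<open>c l\<close> has to avoid the later
  \<open>c\<close> and the earlier \<open>u\<close>, fewer vectors than the dimension, so a unit
  vector orthogonal to them always exists.\<close>

lemma orthonormal_flag:
  fixes u :: "'n::finite \<Rightarrow> real^'n" and \<rho> :: "'n \<Rightarrow> nat"
  assumes \<rho>: "inj \<rho>"
  shows "\<exists>c :: 'n \<Rightarrow> real^'n. (\<forall>i j. c i \<bullet> c j = (if i = j then 1 else 0)) \<and>
    (\<forall>i j. \<rho> j < \<rho> i \<longrightarrow> c i \<bullet> u j = 0)"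
proof -
  define Q where "Q k c \<longleftrightarrow> (\<forall>i j. k \<le> \<rho> i \<longrightarrow> k \<le> \<rho> j \<longrightarrow> c i \<bullet> c j = (if i = j then 1 else 0)) \<and>
    (\<forall>i j. k \<le> \<rho> i \<longrightarrow> \<rho> j < \<rho> i \<longrightarrow> c i \<bullet> u j = 0)" for k and c :: "'n \<Rightarrow> real^'n"
  define K where "K = Suc (Max (range \<rho>))"
  have K: "\<rho> i < K" for i by (simp add: K_def less_Suc_eq_le)
  have "0 \<le> K" by simp
  then have "\<exists>c. Q 0 c"
  proof (induction rule: inc_induct)
    case base
    then show ?case using K by (auto simp: Q_def not_le[symmetric])
  next
    case (step k)
    then obtain c where c: "Q (Suc k) c" by blast
    show ?case
    proof (cases "\<exists>l. \<rho> l = k")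
      case False
      then have "k \<le> \<rho> i \<longleftrightarrow> Suc k \<le> \<rho> i" for i by (metis Suc_leD le_antisym not_less_eq_eq)
      then have "Q k c" using c by (simp add: Q_def)
      then show ?thesis by blast
    next
      case True
      then obtain l where l: "\<rho> l = k" by blast
      define S where "S = (\<lambda>j. if \<rho> j < k then u j else c j) ` (UNIV - {l})"
      have "dim S \<le> card S" by (rule dim_le_card') (simp add: S_def)
      also have "card S \<le> card (UNIV - {l})" unfolding S_def by (rule card_image_le) simp
      also have "\<dots> < DIM(real^'n)" by (simp add: card_Diff_singleton)
      finally obtain z where z: "z \<noteq> 0" "\<And>y. y \<in> span S \<Longrightarrow> orthogonal z y"
        using orthogonal_to_subspace_exists by blast
      define y where "y = z /\<^sub>R norm z"
      have zS: "z \<bullet> s = 0" if "s \<in> S" for s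
        using z(2)[OF span_base[OF that]] by (simp add: orthogonal_def)
      have y1: "y \<bullet> y = 1"
        using z(1) by (simp add: y_def inner_commute dot_square_norm power2_eq_square)
      have yu: "y \<bullet> u j = 0" if "\<rho> j < k" for j
      proof -
        have "u j \<in> S" unfolding S_def by (rule image_eqI[of _ _ j]) (use that l in auto)
        then show ?thesis using zS by (simp add: y_def)
      qed
      have yc: "y \<bullet> c j = 0" if "k < \<rho> j" for j
      proof -
        have "c j \<in> S" unfolding S_def by (rule image_eqI[of _ _ j]) (use that l in auto)
        then show ?thesis using zS by (simp add: y_def)
      qed
      have gt: "k < \<rho> i" if "k \<le> \<rho> i" "i \<noteq> l" for i
        using that l \<rho> by (metis injD le_neq_implies_less)
      have "Q k (c(l := y))"
        unfolding Q_def
      proof (intro conjI allI impI)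
        fix i j assume "k \<le> \<rho> i" "k \<le> \<rho> j"
        then show "(c(l := y)) i \<bullet> (c(l := y)) j = (if i = j then 1 else 0)"
          using gt c y1 yc by (auto simp: Q_def inner_commute Suc_le_eq)
      next
        fix i j assume "k \<le> \<rho> i" "\<rho> j < \<rho> i"
        then show "(c(l := y)) i \<bullet> u j = 0"
          using gt c yu l by (auto simp: Q_def Suc_le_eq)
      qed
      then show ?thesis by blast
    qed
  qed
  then show ?thesis by (auto simp: Q_def)
qed

lemma orthonormal_parseval:
  fixes c :: "'n::finite \<Rightarrow> real^'n"
  assumes "\<And>i j. c i \<bullet> c j = (if i = j then 1 else 0)"
  shows "a \<bullet> b = (\<Sum>i\<in>UNIV. (c i \<bullet> a) * (c i \<bullet> b))"
proof -
  define A where "A = (\<chi> i. c i)"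
  have "A ** transpose A = mat 1"
    using assms by (simp add: A_def vec_eq_iff matrix_matrix_mult_def transpose_def mat_def inner_vec_def)
  then have "transpose A ** A = mat 1" using matrix_left_right_inverse by blast
  then have "b = transpose A *v (A *v b)" by (simp add: matrix_vector_mul_assoc)
  then have "a \<bullet> b = (A *v a) \<bullet> (A *v b)"
    by (metis dot_lmul_matrix transpose_matrix_vector transpose_transpose)
  also have "\<dots> = (\<Sum>i\<in>UNIV. (c i \<bullet> a) * (c i \<bullet> b))"
    unfolding inner_vec_def[of "A *v a"] matrix_vector_mul_component by (simp add: A_def)
  finally show ?thesis .
qed

text \<open>If some diagonal entry of the triangular normal form vanished, the edge lengths would be
  algebraic over fewer than \<open>card E\<close> coordinates.\<close>

lemma free_lengths_spanning:
  fixes q :: "'a \<Rightarrow> real^'n" and w :: "'n \<Rightarrow> 'a"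
  assumes G: "simple_graph V E" and free: "free_family E (sq_length q)"
    and x: "x \<in> V" and w: "inj w" "range w \<subseteq> V - {x}" and \<rho>: "inj \<rho>"
    and card: "card (pinned_coords V x w \<rho>) \<le> card E"
  shows "spanning (\<lambda>i. q (w i) - q x)"
proof -
  note fin = simple_graph_finite[OF G]
  let ?I = "pinned_coords V x w \<rho>"
  define u where "u i = q (w i) - q x" for i
  obtain c :: "'n \<Rightarrow> real^'n" where c: "\<And>i j. c i \<bullet> c j = (if i = j then 1 else 0)"
      "\<And>i j. \<rho> j < \<rho> i \<Longrightarrow> c i \<bullet> u j = 0"
    using orthonormal_flag[OF \<rho>, of u] by blast
  \<comment> \<open>Coordinates of \<open>q\<close> in the frame \<open>c\<close> with origin at
    \<open>x\<close>, the triangular normal form. Lengths are polynomials in these numbers alone, so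
    \<open>D\<close> is never applied to the frame, about whose entries nothing is known.\<close>
  define z where "z = (\<lambda>(v, i). c i \<bullet> (q v - q x))"
  have diag: "c k \<bullet> u k \<noteq> 0" for k
  proof
    assume k: "c k \<bullet> u k = 0"
    have kI: "(w k, k) \<in> ?I" using w injD[OF w(1)] by (auto simp: pinned_coords_def)
    have "card E \<le> card (?I - {(w k, k)})"
    proof (rule free_family_card_le[OF fin(2) _ free])
      show "finite (?I - {(w k, k)})" using finite_pinned_coords[OF fin(1)] by simp
      fix D e assume D: "derivation D" "\<forall>j\<in>?I - {(w k, k)}. D (z j) = 0" and e: "e \<in> E"
      have Dz: "D (z (v, i)) = 0" if v: "v \<in> V" for v i
      proof -
        consider "v = x" | "(v, i) \<in> ?I - {(w k, k)}" | "(v, i) = (w k, k)"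
          | j where "v = w j" "\<rho> j < \<rho> i"
          using v unfolding pinned_coords_def by simp (metis not_le)
        then show ?thesis
        proof cases
          case 1
          then show ?thesis using D(1) by (simp add: z_def derivation_zero)
        next
          case 2
          then show ?thesis using D(2) by blast
        next
          case 3
          then have "z (v, i) = 0" using k by (simp add: z_def u_def)
          then show ?thesis using D(1) by (simp add: derivation_zero)
        next
          case 4
          then have "z (v, i) = 0" using c(2) by (simp add: z_def u_def)
          then show ?thesis using D(1) by (simp add: derivation_zero)
        qed
      qed
      obtain a b where ab: "a \<in> V" "b \<in> V" "e = {a, b}" using simple_graph_edge[OF G e] by blast
      have "c i \<bullet> (q a - q b) = z (a, i) - z (b, i)" for i
        by (simp add: z_def inner_diff_right)
      then have "sq_length q e = (\<Sum>i\<in>UNIV. (z (a, i) - z (b, i)) * (z (a, i) - z (b, i)))"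
        unfolding ab(3) edge_form_pair
        by (subst orthonormal_parseval[of c, OF c(1)]) simp
      then show "D (sq_length q e) = 0"
        using D(1) Dz ab by (simp add: derivation_sum derivation_mult derivation_diff)
    qed
    moreover have "card (?I - {(w k, k)}) < card ?I"
      using kI finite_pinned_coords[OF fin(1)] by (intro psubset_card_mono) auto
    ultimately show False using card by simp
  qed
  show ?thesis
    unfolding spanning_def u_def[symmetric]
  proof (intro allI impI)
    fix y assume y: "\<forall>i. u i \<bullet> y = 0"
    \<comment> \<open>Forward substitution in a triangular system: terms of higher index vanish by
      the flag, those of lower index by induction, and the diagonal entry is nonzero.\<close>
    have "c i \<bullet> y = 0" for i
    proof (induction "\<rho> i" arbitrary: i rule: less_induct)
      case less
      have "0 = u i \<bullet> y" using y by simp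
      also have "\<dots> = (\<Sum>l\<in>UNIV. (c l \<bullet> u i) * (c l \<bullet> y))"
        by (rule orthonormal_parseval[OF c(1)])
      also have "\<dots> = (\<Sum>l\<in>UNIV. if l = i then (c i \<bullet> u i) * (c i \<bullet> y) else 0)"
      proof (rule sum.cong)
        fix l
        have "l = i \<or> \<rho> l < \<rho> i \<or> \<rho> i < \<rho> l" using injD[OF \<rho>] by (metis linorder_neqE_nat)
        then show "(c l \<bullet> u i) * (c l \<bullet> y) = (if l = i then (c i \<bullet> u i) * (c i \<bullet> y) else 0)"
          using less c(2) by auto
      qed simp
      finally show ?case using diag by simp
    qed
    then have "y \<bullet> y = 0" using orthonormal_parseval[of c, OF c(1), of y y] by simp
    then show "y = 0" by simp
  qed
qed

text \<open>Equal distances give equal Gram matrices of the vectors from \<open>x\<close>, so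
  \<open>M = B ** A\<close>, with \<open>B\<close> the inverse of \<open>A'\<close>, is orthogonal;
  every further vertex is determined by its inner products with the basis.\<close>

lemma congruent_real_if_sq_lengths_eq:
  fixes q q' :: "'a \<Rightarrow> real^'n"
  assumes x: "x \<in> V" and w: "range w \<subseteq> V" and sp: "spanning (\<lambda>i. q (w i) - q x)"
    and eq: "\<And>u v. u \<in> V \<Longrightarrow> v \<in> V \<Longrightarrow> sq_length q {u, v} = sq_length q' {u, v}"
    and sp': "spanning (\<lambda>i. q' (w i) - q' x)"
  shows "congruent_real V q q'"
proof -
  define A A' where "A = (\<chi> i. q (w i) - q x)" and "A' = (\<chi> i. q' (w i) - q' x)"
  have inner: "(q u - q x) \<bullet> (q v - q x) = (q' u - q' x) \<bullet> (q' v - q' x)" if "u \<in> V" "v \<in> V" for u v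
  proof -
    have "2 * ((q u - q x) \<bullet> (q v - q x))
        = sq_length q {u, x} + sq_length q {v, x} - sq_length q {u, v}"
      by (simp add: edge_form_pair inner_diff_left inner_diff_right inner_commute)
    also have "\<dots> = sq_length q' {u, x} + sq_length q' {v, x} - sq_length q' {u, v}"
      using eq that x by simp
    also have "\<dots> = 2 * ((q' u - q' x) \<bullet> (q' v - q' x))"
      by (simp add: edge_form_pair inner_diff_left inner_diff_right inner_commute)
    finally show ?thesis by simp
  qed
  have AA: "A ** transpose A = A' ** transpose A'"
  proof -
    have "w i \<in> V" for i using w by blast
    then show ?thesis
      using inner by (simp add: A_def A'_def vec_eq_iff matrix_matrix_mult_def transpose_def inner_vec_def)
  qed
  obtain B where B: "B ** A' = mat 1"
    using sp' unfolding spanning_iff_left_invertible A'_def by blast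
  then have B': "A' ** B = mat 1" using matrix_left_right_inverse by blast
  define M where "M = B ** A"
  have "M ** transpose M = B ** (A ** transpose A) ** transpose B"
    by (simp add: M_def matrix_transpose_mul matrix_mul_assoc)
  also have "\<dots> = (B ** A') ** transpose (B ** A')"
    unfolding AA by (simp add: matrix_transpose_mul matrix_mul_assoc)
  finally have "M ** transpose M = mat 1" by (simp add: B)
  then have "orthogonal_matrix M"
    unfolding orthogonal_matrix_def using matrix_left_right_inverse by blast
  then have "orthogonal_transformation ((*v) M)"
    by (simp add: orthogonal_transformation_matrix)
  then have norm: "norm (M *v a) = norm a" for a by (rule orthogonal_transformation_norm)
  define f where "f a = q' x + M *v (a - q x)" for a
  have "dist (f a) (f b) = dist a b" for a b
  proof -
    have "f a - f b = M *v (a - b)"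
      by (simp add: f_def matrix_vector_mult_diff_distrib)
    then show ?thesis by (simp add: dist_norm norm)
  qed
  moreover have "q' v = f (q v)" if v: "v \<in> V" for v
  proof -
    have "A *v (q v - q x) = A' *v (q' v - q' x)"
    proof -
      have "w i \<in> V" for i using w by blast
      then show ?thesis
        using inner v by (simp add: vec_eq_iff matrix_vector_mul_component A_def A'_def)
    qed
    then have "M *v (q v - q x) = B *v (A' *v (q' v - q' x))"
      by (simp add: M_def matrix_vector_mul_assoc[symmetric])
    also have "\<dots> = q' v - q' x" by (simp add: matrix_vector_mul_assoc B)
    finally show ?thesis by (simp add: f_def)
  qed
  ultimately show ?thesis unfolding congruent_real_def by blast
qed

section \<open>Spider splits\<close>

lemma min_d_rigid_equivalent_framework:
  fixes p q :: "'a \<Rightarrow> real^'n" and w :: "'n \<Rightarrow> 'a"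
  assumes G: "simple_graph V E" and min: "min_d_rigid TYPE('n) V E"
    and gen: "generic V p" and eqv: "equivalent_real E p q"
    and x: "x \<in> V" and w: "inj w" "range w \<subseteq> V - {x}"
  shows "independent_framework E q" "spanning (\<lambda>i. q (w i) - q x)"
proof -
  obtain p0 :: "'a \<Rightarrow> real^'n" where p0: "generic V p0" "rigid_framework V E p0"
    using min by (auto simp: min_d_rigid_def d_rigid_def)
  moreover have "\<not> rigid_framework V (E - {e}) p0" if "e \<in> E" for e
    using min p0(1) that by (auto simp: min_d_rigid_def d_rigid_def)
  ultimately have ind: "independent_framework E p0"
    using minimally_rigid_independent[OF G] by blast
  then have "free_family E (sq_length p)"
    using generic_free_lengths_transfer[OF G p0(1) gen] independent_framework_free[OF G p0(1)] by blast
  \<comment> \<open>\<open>free_family\<close> speaks only of the numbers themselves, and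
    \<open>q\<close> has the same ones as \<open>p\<close>.\<close>
  then have free: "free_family E (sq_length q)"
    using eqv unfolding equivalent_real_iff_sq_length[OF G] free_family_def by simp
  then show "independent_framework E q" by (rule free_independent_framework[OF G])
  obtain \<rho> :: "'n \<Rightarrow> nat" where \<rho>: "inj \<rho>"
    using finite_imp_inj_to_nat_seg[of "UNIV :: 'n set"] by auto
  have "card (pinned_coords V x w \<rho>) \<le> card E"
    by (rule card_pinned_coords_le[OF G p0 ind x w \<rho>])
  then show "spanning (\<lambda>i. q (w i) - q x)"
    by (rule free_lengths_spanning[OF G free x w \<rho>])
qed

section \<open>Counting congruence classes\<close>

lemma congruent_real_refl: "congruent_real V q q"
  unfolding congruent_real_def by (intro exI[of _ "\<lambda>a. a"]) simp

lemma congruent_real_sq_length: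
  "congruent_real V q q' \<Longrightarrow> u \<in> V \<Longrightarrow> v \<in> V \<Longrightarrow> sq_length q {u, v} = sq_length q' {u, v}"
  by (auto simp: congruent_real_def sq_length_pair)

text \<open>Reflexivity of congruence suffices: if \<open>q\<close> and \<open>q'\<close> had the
  same class, \<open>q'\<close> would lie in the class of \<open>q\<close>.\<close>

lemma num_classes_ge:
  assumes "finite Q" "Q \<subseteq> V \<rightarrow>\<^sub>E UNIV" "\<And>q. q \<in> Q \<Longrightarrow> equivalent_real E p q"
    and ncong: "\<And>q q'. q \<in> Q \<Longrightarrow> q' \<in> Q \<Longrightarrow> q \<noteq> q' \<Longrightarrow> \<not> congruent_real V q q'"
  shows "enat (card Q) \<le> num_classes V E p"
proof -
  define R r where "R = {q \<in> V \<rightarrow>\<^sub>E UNIV. equivalent_real E p q}"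
    and "r = {(q, q'). q \<in> R \<and> q' \<in> R \<and> congruent_real V q q'}"
  have QR: "Q \<subseteq> R" using assms(2,3) by (auto simp: R_def)
  have "card Q \<le> card (R // r)" if "finite (R // r)"
  proof (rule card_inj_on_le[OF _ _ that])
    show "(\<lambda>q. r `` {q}) ` Q \<subseteq> R // r" using QR by (auto intro: quotientI)
    show "inj_on (\<lambda>q. r `` {q}) Q"
    proof (rule inj_onI, rule ccontr)
      fix q q' assume q: "q \<in> Q" "q' \<in> Q" "r `` {q} = r `` {q'}" "q \<noteq> q'"
      then have "q' \<in> r `` {q'}" using QR congruent_real_refl by (auto simp: r_def)
      then have "congruent_real V q q'" using q(3) by (auto simp: r_def)
      then show False using ncong q by blast
    qed
  qed
  then show ?thesis
    by (simp add: num_classes_def R_def[symmetric] r_def[symmetric] Let_def)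
qed

text \<open>The hypothesis \<open>cong\<close> turns congruence into equality of all distances, an
  equivalence relation, so different classes are told apart by some distance, a difference that
  survives perturbation. If there are infinitely many classes, any \<open>n\<close> of them are
  taken.\<close>

lemma num_classes_representatives:
  assumes n: "enat n \<le> num_classes V E p"
    and cong: "\<And>q q'. equivalent_real E p q \<Longrightarrow> equivalent_real E p q' \<Longrightarrow>
      (\<And>u v. u \<in> V \<Longrightarrow> v \<in> V \<Longrightarrow> sq_length q {u, v} = sq_length q' {u, v}) \<Longrightarrow> congruent_real V q q'"
  obtains Q where "finite Q" "card Q = n" "\<And>q. q \<in> Q \<Longrightarrow> equivalent_real E p q"
    "\<And>q q'. q \<in> Q \<Longrightarrow> q' \<in> Q \<Longrightarrow> q \<noteq> q' \<Longrightarrow>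
      \<exists>u\<in>V. \<exists>v\<in>V. sq_length q {u, v} \<noteq> sq_length q' {u, v}"
proof -
  define R r where "R = {q \<in> V \<rightarrow>\<^sub>E UNIV. equivalent_real E p q}"
    and "r = {(q, q'). q \<in> R \<and> q' \<in> R \<and> congruent_real V q q'}"
  have r: "(q, q') \<in> r \<longleftrightarrow> q \<in> R \<and> q' \<in> R \<and> (\<forall>u\<in>V. \<forall>v\<in>V. sq_length q {u, v} = sq_length q' {u, v})" for q q'
    using cong congruent_real_sq_length by (auto simp: r_def R_def)
  have "if finite (R // r) then n \<le> card (R // r) else True"
    using n by (simp add: num_classes_def R_def[symmetric] r_def[symmetric] Let_def split: if_splits)
  then obtain C where C: "C \<subseteq> R // r" "finite C" "card C = n"
    using obtain_subset_with_card_n infinite_arbitrarily_large by metis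
  have "\<forall>c\<in>C. \<exists>q\<in>R. c = r `` {q}" using C(1) by (auto elim!: quotientE)
  then obtain f where f: "\<And>c. c \<in> C \<Longrightarrow> f c \<in> R \<and> c = r `` {f c}" by metis
  have "inj_on f C" by (rule inj_onI) (metis f)
  then have "card (f ` C) = n" using C(3) card_image by blast
  moreover have "\<exists>u\<in>V. \<exists>v\<in>V. sq_length q {u, v} \<noteq> sq_length q' {u, v}"
    if q: "q \<in> f ` C" "q' \<in> f ` C" "q \<noteq> q'" for q q'
  proof (rule ccontr)
    assume eq: "\<not> ?thesis"
    obtain c c' where c: "c \<in> C" "c' \<in> C" "q = f c" "q' = f c'" using q by blast
    have "q \<in> R" "q' \<in> R" using c f by blast+
    then have "r `` {q} = r `` {q'}" using eq by (auto simp: r)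
    then have "c = c'" using c f by metis
    then show False using c q(3) by blast
  qed
  ultimately show thesis
    using that[of "f ` C"] C(2) f by (auto simp: R_def)
qed

section \<open>Perturbation to generic frameworks\<close>

lemma alg_indep_Q_cong:
  assumes "alg_indep_Q I y" "\<And>i. i \<in> I \<Longrightarrow> y i = y' i"
  shows "alg_indep_Q I y'"
proof -
  have eq: "(\<Prod>i\<in>I. y i ^ m i) = (\<Prod>i\<in>I. y' i ^ m i)" for m
    by (rule prod.cong) (simp_all add: assms(2))
  show ?thesis using assms(1) unfolding alg_indep_Q_def eq .
qed

lemma generic_dense:
  fixes p :: "'a \<Rightarrow> real^'n"
  assumes "finite V" "\<epsilon> > 0"
  shows "\<exists>p'\<in>V \<rightarrow>\<^sub>E UNIV. generic V p' \<and> (\<forall>v\<in>V. dist (p' v) (p v) < \<epsilon>)"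
proof -
  define y0 where "y0 = (\<lambda>(v, i). p v $ i)"
  define \<eta> where "\<eta> = \<epsilon> / real (CARD('n) + 1)"
  have \<eta>: "\<eta> > 0" using assms(2) by (simp add: \<eta>_def)
  obtain y where y: "alg_indep_Q (V \<times> (UNIV :: 'n set)) y"
      "\<forall>vi\<in>V \<times> UNIV. \<bar>y vi - y0 vi\<bar> < \<eta>"
    using alg_indep_Q_dense[of "V \<times> (UNIV :: 'n set)" \<eta> y0] assms(1) \<eta> by auto
  define p' :: "'a \<Rightarrow> real^'n" where "p' v = (if v \<in> V then \<chi> i. y (v, i) else undefined)" for v
  have "generic V p'"
    unfolding generic_def by (rule alg_indep_Q_cong[OF y(1)]) (auto simp: p'_def)
  moreover have "dist (p' v) (p v) < \<epsilon>" if v: "v \<in> V" for v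
  proof -
    have "dist (p' v) (p v) \<le> (\<Sum>i\<in>UNIV. \<bar>(p' v - p v) $ i\<bar>)"
      unfolding dist_norm by (rule norm_le_l1_cart)
    also have "\<dots> \<le> (\<Sum>i\<in>(UNIV :: 'n set). \<eta>)"
      using y(2) v by (intro sum_mono) (force simp: p'_def y0_def less_imp_le)
    also have "\<dots> < (real (CARD('n) + 1)) * \<eta>" using \<eta> by (simp add: algebra_simps)
    also have "\<dots> = \<epsilon>" by (simp add: \<eta>_def)
    finally show ?thesis .
  qed
  moreover have "p' \<in> V \<rightarrow>\<^sub>E UNIV" by (auto simp: p'_def)
  ultimately show ?thesis by blast
qed

lemma finite_uniform_positive:
  fixes P :: "'i \<Rightarrow> real \<Rightarrow> bool"
  assumes "finite S" "\<And>s. s \<in> S \<Longrightarrow> \<exists>\<epsilon>>0. P s \<epsilon>"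
    and "\<And>s \<epsilon> \<epsilon>'. P s \<epsilon> \<Longrightarrow> 0 < \<epsilon>' \<Longrightarrow> \<epsilon>' \<le> \<epsilon> \<Longrightarrow> P s \<epsilon>'"
  shows "\<exists>\<epsilon>>0. \<forall>s\<in>S. P s \<epsilon>"
  using assms(1,2)
proof (induction S rule: finite_induct)
  case empty
  show ?case by (auto intro: exI[of _ 1])
next
  case (insert s S)
  then obtain \<epsilon>1 \<epsilon>2 where "\<epsilon>1 > 0" "P s \<epsilon>1" "\<epsilon>2 > 0" "\<forall>s\<in>S. P s \<epsilon>2" by blast
  then have "\<forall>t\<in>insert s S. P t (min \<epsilon>1 \<epsilon>2)"
    using assms(3) by (metis insertE min.cobounded1 min.cobounded2 min_less_iff_conj)
  then show ?case using \<open>\<epsilon>1 > 0\<close> \<open>\<epsilon>2 > 0\<close> by (intro exI[of _ "min \<epsilon>1 \<epsilon>2"]) simp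
qed

lemma incongruent_open:
  assumes uv: "u \<in> V" "v \<in> V" and ne: "sq_length q {u, v} \<noteq> sq_length q' {u, v}"
  shows "\<exists>\<epsilon>>0. \<forall>a a'. (\<forall>v\<in>V. dist (a v) (q v) < \<epsilon>) \<longrightarrow> (\<forall>v\<in>V. dist (a' v) (q' v) < \<epsilon>) \<longrightarrow>
    \<not> congruent_real V a a'"
proof -
  \<comment> \<open>Half the gap: two errors below this cannot close it.\<close>
  define \<eta> where "\<eta> = \<bar>sq_length q {u, v} - sq_length q' {u, v}\<bar> / 2"
  have \<eta>: "\<eta> > 0" using ne by (simp add: \<eta>_def)
  obtain \<epsilon>1 where \<epsilon>1: "\<epsilon>1 > 0" "\<And>a. dist (a u) (q u) < \<epsilon>1 \<Longrightarrow> dist (a v) (q v) < \<epsilon>1 \<Longrightarrow>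
      \<bar>sq_length a {u, v} - sq_length q {u, v}\<bar> < \<eta>"
    using sq_length_continuous[OF \<eta>, of u q v] by blast
  obtain \<epsilon>2 where \<epsilon>2: "\<epsilon>2 > 0" "\<And>a. dist (a u) (q' u) < \<epsilon>2 \<Longrightarrow> dist (a v) (q' v) < \<epsilon>2 \<Longrightarrow>
      \<bar>sq_length a {u, v} - sq_length q' {u, v}\<bar> < \<eta>"
    using sq_length_continuous[OF \<eta>, of u q' v] by blast
  show ?thesis
  proof (intro exI conjI allI impI notI)
    show "min \<epsilon>1 \<epsilon>2 > 0" using \<epsilon>1 \<epsilon>2 by simp
    fix a a' assume near: "\<forall>v\<in>V. dist (a v) (q v) < min \<epsilon>1 \<epsilon>2" "\<forall>v\<in>V. dist (a' v) (q' v) < min \<epsilon>1 \<epsilon>2"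
      and cong: "congruent_real V a a'"
    have "sq_length a {u, v} = sq_length a' {u, v}"
      by (rule congruent_real_sq_length[OF cong uv])
    moreover have "\<bar>sq_length a {u, v} - sq_length q {u, v}\<bar> < \<eta>"
      using near uv by (intro \<epsilon>1) auto
    moreover have "\<bar>sq_length a' {u, v} - sq_length q' {u, v}\<bar> < \<eta>"
      using near uv by (intro \<epsilon>2) auto
    ultimately show False unfolding \<eta>_def by (simp add: abs_if split: if_splits)
  qed
qed

section \<open>The split graph and its frameworks\<close>

text \<open>A new vertex may reuse the name \<open>x\<close>, so the tests for \<open>x1\<close> and
  \<open>x2\<close> come first.\<close>

definition split_framework :: "'a \<Rightarrow> 'a \<Rightarrow> 'a \<Rightarrow> ('a \<Rightarrow> 'b) \<Rightarrow> 'a \<Rightarrow> 'b" where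
  "split_framework x x1 x2 q v = (if v = x1 \<or> v = x2 then q x else q v)"

context
  fixes d :: nat and V :: "'a set" and E x N1 N2 W x1 x2 V' E'
  assumes G: "simple_graph V E" and S: "spider_split d V E x N1 N2 W x1 x2 V' E'"
begin

lemma spider_split_vertices:
  "x \<in> V" "x1 \<noteq> x2" "x1 \<notin> V - {x}" "x2 \<notin> V - {x}" "V' = (V - {x}) \<union> {x1, x2}"
  "finite W" "card W = d"
  using S unfolding spider_split_def by simp_all

lemma spider_split_neighbour:
  assumes "v \<in> N1 \<union> N2 \<union> W"
  shows "{x, v} \<in> E" "v \<in> V" "v \<noteq> x" "v \<noteq> x1" "v \<noteq> x2"
proof -
  show xv: "{x, v} \<in> E" using S assms by (auto simp: spider_split_def nbhd_def)
  show "v \<in> V" "v \<noteq> x"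
    using simple_graph_edge[OF G xv] by (auto simp: doubleton_eq_iff)
  then show "v \<noteq> x1" "v \<noteq> x2" using spider_split_vertices by auto
qed

text \<open>The edges at \<open>x2\<close> are separated into those to \<open>N2\<close> and those
  to \<open>W\<close>, because only the latter have a twin at \<open>x1\<close>.\<close>

lemma spider_split_edge_cases:
  assumes "e \<in> E'"
  obtains (old) u v where "e \<in> E" "x \<notin> e" "e = {u, v}" "u \<in> V - {x}" "v \<in> V - {x}" "u \<noteq> v"
  | (first) v where "v \<in> N1 \<union> W" "e = {x1, v}"
  | (second) v where "v \<in> N2" "e = {x2, v}"
  | (double) v where "v \<in> W" "e = {x2, v}"
proof -
  consider "e \<in> E" "x \<notin> e" | v where "v \<in> N1 \<union> W" "e = {x1, v}" | v where "v \<in> N2 \<union> W" "e = {x2, v}"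
    using S assms unfolding spider_split_def by blast
  then show thesis
  proof cases
    case 1
    obtain u v where "u \<in> V" "v \<in> V" "u \<noteq> v" "e = {u, v}" using simple_graph_edge[OF G 1(1)] by blast
    then show thesis using 1 old by blast
  qed (use first second double in blast)+
qed

lemma spider_split_simple_graph: "simple_graph V' E'"
  unfolding simple_graph_def
proof (intro conjI ballI)
  show "finite V'" using G spider_split_vertices by (simp add: simple_graph_def)
  fix e assume "e \<in> E'"
  then show "\<exists>u v. u \<in> V' \<and> v \<in> V' \<and> u \<noteq> v \<and> e = {u, v}"
  proof (cases rule: spider_split_edge_cases)
    case (old u v)
    then show ?thesis using spider_split_vertices by blast
  next
    case (first v)
    then show ?thesis
      using spider_split_neighbour[of v] spider_split_vertices(5) by (intro exI[of _ x1] exI[of _ v]) auto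
  next
    case (second v)
    then show ?thesis
      using spider_split_neighbour[of v] spider_split_vertices(5) by (intro exI[of _ x2] exI[of _ v]) auto
  next
    case (double v)
    then show ?thesis
      using spider_split_neighbour[of v] spider_split_vertices(5) by (intro exI[of _ x2] exI[of _ v]) auto
  qed
qed

abbreviation "spl \<equiv> split_framework x x1 x2"

lemma split_framework_new: "spl q x1 = q x" "spl q x2 = q x"
  by (auto simp: split_framework_def)

lemma split_framework_old: "v \<in> V - {x} \<Longrightarrow> spl q v = q v"
  using spider_split_vertices(3,4) by (auto simp: split_framework_def)

lemma split_framework_neighbour: "v \<in> N1 \<union> N2 \<union> W \<Longrightarrow> spl q v = q v"
  using spider_split_neighbour(2,3)[of v] by (simp add: split_framework_old)

lemma split_framework_equivalent:
  fixes p q :: "'a \<Rightarrow> real^'n"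
  assumes "equivalent_real E p q" "e \<in> E'"
  shows "sq_length (spl p) e = sq_length (spl q) e"
proof -
  have eqv: "sq_length p e = sq_length q e" if "e \<in> E" for e
    using assms(1) that equivalent_real_iff_sq_length[OF G] by blast
  show ?thesis using assms(2)
  proof (cases rule: spider_split_edge_cases)
    case (old u v)
    then show ?thesis using eqv[of e] by (simp add: edge_form_pair split_framework_old)
  next
    case (first v)
    then have "v \<in> N1 \<union> N2 \<union> W" by blast
    then show ?thesis using first eqv[of "{x, v}"] spider_split_neighbour[of v]
      by (simp add: edge_form_pair split_framework_new split_framework_neighbour)
  next
    case (second v)
    then show ?thesis using eqv[of "{x, v}"] spider_split_neighbour[of v]
      by (simp add: edge_form_pair split_framework_new split_framework_neighbour)
  next
    case (double v)
    then show ?thesis using eqv[of "{x, v}"] spider_split_neighbour[of v]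
      by (simp add: edge_form_pair split_framework_new split_framework_neighbour)
  qed
qed

text \<open>The edges at \<open>W\<close> determine the difference \<open>\<delta>\<close> of the velocities of \<open>x2\<close> and \<open>x1\<close>; once it is
  known, the remaining conditions are conditions on a velocity field of the original graph.\<close>

lemma split_framework_independent:
  fixes q :: "'a \<Rightarrow> real^'n" and w :: "'n \<Rightarrow> 'a"
  assumes ind: "independent_framework E q" and w: "range w = W"
    and sp: "spanning (\<lambda>i. q (w i) - q x)"
  shows "independent_framework E' (spl q)"
  unfolding independent_framework_def
proof
  fix b :: "'a set \<Rightarrow> real"
  obtain \<delta> where \<delta>: "\<And>i. (q (w i) - q x) \<bullet> \<delta> = b {x1, w i} - b {x2, w i}"
    using spanning_solve[OF sp, of "\<lambda>i. b {x1, w i} - b {x2, w i}"] by blast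
  have \<delta>W: "(q x - q v) \<bullet> \<delta> = b {x2, v} - b {x1, v}" if v: "v \<in> W" for v
  proof -
    obtain i where "v = w i" using v w by blast
    then show ?thesis using \<delta>[of i] by (simp add: inner_diff_left algebra_simps)
  qed
  \<comment> \<open>The value to be attained on \<open>{x, v}\<close> in the original graph: that of
    \<open>{x1, v}\<close>, as \<open>x1\<close> takes over the velocity of \<open>x\<close>, and
    for \<open>v\<close> in \<open>N2\<close> that of \<open>{x2, v}\<close> less the contribution
    of \<open>\<delta>\<close>.\<close>
  define c where "c v = (if v \<in> N2 then b {x2, v} - (q x - q v) \<bullet> \<delta> else b {x1, v})" for v
  define b' where "b' e = (if x \<in> e then c (SOME v. e = {x, v}) else b e)" for e
  have b'x: "b' {x, v} = c v" for v
  proof -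
    have "(SOME u. {x, v} = {x, u}) = v" by (rule some_equality) (auto simp: doubleton_eq_iff)
    then show ?thesis by (simp add: b'_def)
  qed
  obtain m where m: "\<And>e. e \<in> E \<Longrightarrow> edge_form q m e = b' e"
    using independent_frameworkD[OF ind] by blast
  have mx: "(q x - q v) \<bullet> (m x - m v) = c v" if v: "v \<in> N1 \<union> N2 \<union> W" for v
    using m[OF spider_split_neighbour(1)[OF v]] by (simp add: edge_form_pair b'x)
  have disj: "v \<notin> N2" if "v \<in> N1 \<union> W" for v
    using S that by (auto simp: spider_split_def)
  define m' where "m' v = (if v = x1 then m x else if v = x2 then m x + \<delta> else m v)" for v
  have m'_new: "m' x1 = m x" "m' x2 = m x + \<delta>"
    using spider_split_vertices(2) by (auto simp: m'_def)
  have m'_old: "m' v = m v" if "v \<in> V - {x}" for v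
    using that spider_split_vertices(3,4) by (auto simp: m'_def)
  have m'_nb: "m' v = m v" if "v \<in> N1 \<union> N2 \<union> W" for v
    using spider_split_neighbour[OF that] by (intro m'_old) auto
  have second: "edge_form (spl q) m' {x2, v} = c v + (q x - q v) \<bullet> \<delta>" if "v \<in> N1 \<union> N2 \<union> W" for v
    using mx[OF that] that
    by (simp add: edge_form_pair split_framework_new split_framework_neighbour m'_new m'_nb
        inner_diff_right inner_add_right algebra_simps)
  have "edge_form (spl q) m' e = b e" if "e \<in> E'" for e
    using that
  proof (cases rule: spider_split_edge_cases)
    case (old u v)
    then show ?thesis
      using m[of e] by (simp add: edge_form_pair split_framework_old m'_old b'_def)
  next
    case (first v)
    then have "v \<in> N1 \<union> N2 \<union> W" by blast
    then show ?thesis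
      using first mx[of v] disj[of v]
      by (simp add: edge_form_pair split_framework_new split_framework_neighbour m'_new m'_nb c_def)
  next
    case v: (second v)
    then show ?thesis using second[of v] by (simp add: c_def)
  next
    case (double v)
    then show ?thesis using second[of v] disj[of v] \<delta>W[of v] by (simp add: c_def)
  qed
  then show "\<exists>m. \<forall>e\<in>E'. edge_form (spl q) m e = b e" by blast
qed

end

section \<open>Transfer of the count to the split graph\<close>

text \<open>The radii are chosen backwards: \<open>\<epsilon>\<close> keeps perturbations of
  different \<open>q\<close> incongruent, \<open>\<delta>\<close> lets nearby lengths be realised
  within \<open>\<epsilon>\<close>, and \<open>\<eta>\<close> brings the lengths of
  \<open>p'\<close> within \<open>\<delta>\<close>. One \<open>p'\<close> serves all
  \<open>q\<close>, as their split frameworks have equal lengths.\<close>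

lemma spider_split_num_classes:
  fixes p :: "'a \<Rightarrow> real^'n"
  assumes G: "simple_graph V E" and min: "min_d_rigid TYPE('n) V E"
    and S: "spider_split CARD('n) V E x N1 N2 W x1 x2 V' E'"
    and gen: "generic V p" and n: "enat n \<le> num_classes V E p"
  shows "enat n \<le> r_d TYPE('n) V' E'"
proof -
  note verts = spider_split_vertices[OF G S] and G' = spider_split_simple_graph[OF G S]
    and nb = spider_split_neighbour[OF G S]
  note fin' = simple_graph_finite[OF G']
  let ?s = "split_framework x x1 x2 :: ('a \<Rightarrow> real^'n) \<Rightarrow> 'a \<Rightarrow> real^'n"
  obtain w :: "'n \<Rightarrow> 'a" where "bij_betw w UNIV W"
    using finite_same_card_bij[of "UNIV :: 'n set" W] verts by auto
  then have w: "inj w" "range w = W" by (auto simp: bij_betw_def)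
  then have wV: "range w \<subseteq> V - {x}" using nb by blast
  note reg = min_d_rigid_equivalent_framework[OF G min gen _ verts(1) w(1) wV]
  obtain Q where Q: "finite Q" "card Q = n" "\<And>q. q \<in> Q \<Longrightarrow> equivalent_real E p q"
    and Qne: "\<And>q q'. q \<in> Q \<Longrightarrow> q' \<in> Q \<Longrightarrow> q \<noteq> q' \<Longrightarrow>
      \<exists>u\<in>V. \<exists>v\<in>V. sq_length q {u, v} \<noteq> sq_length q' {u, v}"
  proof (rule num_classes_representatives[OF n])
    fix q q' assume "equivalent_real E p q" "equivalent_real E p q'"
      and "\<And>u v. u \<in> V \<Longrightarrow> v \<in> V \<Longrightarrow> sq_length q {u, v} = sq_length q' {u, v}"
    then show "congruent_real V q q'"
      using wV reg(2) by (intro congruent_real_if_sq_lengths_eq[OF verts(1), of w]) auto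
  qed blast
  define N where "N q \<epsilon> a \<longleftrightarrow> (\<forall>v\<in>V'. dist (a v) (?s q v) < \<epsilon>)" for q \<epsilon> and a :: "'a \<Rightarrow> real^'n"
  have N_mono: "N q \<epsilon>' a \<Longrightarrow> \<epsilon>' \<le> \<epsilon> \<Longrightarrow> N q \<epsilon> a" for q \<epsilon> \<epsilon>' a
    by (force simp: N_def)
  have "\<exists>\<epsilon>>0. \<forall>s\<in>{(q, q') \<in> Q \<times> Q. q \<noteq> q'}. case s of (q, q') \<Rightarrow>
      \<forall>a a'. N q \<epsilon> a \<longrightarrow> N q' \<epsilon> a' \<longrightarrow> \<not> congruent_real V' a a'"
  proof (rule finite_uniform_positive)
    show "finite {(q, q') \<in> Q \<times> Q. q \<noteq> q'}"
      by (rule finite_subset[of _ "Q \<times> Q"]) (use Q(1) in auto)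
    fix s assume "s \<in> {(q, q') \<in> Q \<times> Q. q \<noteq> q'}"
    then obtain q q' where s: "s = (q, q')" "q \<in> Q" "q' \<in> Q" "q \<noteq> q'" by blast
    obtain u v where uv: "u \<in> V" "v \<in> V" "sq_length q {u, v} \<noteq> sq_length q' {u, v}"
      using Qne s by blast
    \<comment> \<open>An embedding of \<open>V\<close> into \<open>V'\<close> with \<open>x1\<close>
      standing for \<open>x\<close>; along it the split of \<open>q\<close> restricts to
      \<open>q\<close>, so a distance telling \<open>q\<close> and \<open>q'\<close> apart is still
      present.\<close>
    define \<pi> where "\<pi> v = (if v = x then x1 else v)" for v
    have \<pi>: "\<pi> v \<in> V'" "?s q (\<pi> v) = q v" if "v \<in> V" for v q
      using that verts split_framework_new[OF G S] split_framework_old[OF G S]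
      by (auto simp: \<pi>_def)
    have "sq_length (?s q) {\<pi> u, \<pi> v} \<noteq> sq_length (?s q') {\<pi> u, \<pi> v}"
      using uv by (simp add: edge_form_pair \<pi>)
    from incongruent_open[OF \<pi>(1)[OF uv(1)] \<pi>(1)[OF uv(2)] this]
    show "\<exists>\<epsilon>>0. case s of (q, q') \<Rightarrow> \<forall>a a'. N q \<epsilon> a \<longrightarrow> N q' \<epsilon> a' \<longrightarrow> \<not> congruent_real V' a a'"
      by (simp add: s(1) N_def)
  next
    fix s \<epsilon> \<epsilon>'
    assume "case s of (q, q') \<Rightarrow> \<forall>a a'. N q \<epsilon> a \<longrightarrow> N q' \<epsilon> a' \<longrightarrow> \<not> congruent_real V' a a'"
      and "\<epsilon>' \<le> (\<epsilon> :: real)"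
    then show "case s of (q, q') \<Rightarrow> \<forall>a a'. N q \<epsilon>' a \<longrightarrow> N q' \<epsilon>' a' \<longrightarrow> \<not> congruent_real V' a a'"
      using N_mono by (cases s) fastforce
  qed
  then obtain \<epsilon> where "\<epsilon> > 0" and incong: "\<And>q q' a a'. q \<in> Q \<Longrightarrow> q' \<in> Q \<Longrightarrow> q \<noteq> q' \<Longrightarrow>
      N q \<epsilon> a \<Longrightarrow> N q' \<epsilon> a' \<Longrightarrow> \<not> congruent_real V' a a'"
    by fastforce
  have "\<exists>\<delta>>0. \<forall>q\<in>Q. \<forall>b. (\<forall>e\<in>E'. \<bar>b e - sq_length (?s q) e\<bar> < \<delta>) \<longrightarrow>
      (\<exists>a. N q \<epsilon> a \<and> (\<forall>e\<in>E'. sq_length a e = b e))"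
  proof (rule finite_uniform_positive[OF Q(1)])
    fix q assume q: "q \<in> Q"
    have "independent_framework E' (?s q)"
      by (rule split_framework_independent[OF G S reg(1)[OF Q(3)[OF q]] w(2) reg(2)[OF Q(3)[OF q]]])
    then show "\<exists>\<delta>>0. \<forall>b. (\<forall>e\<in>E'. \<bar>b e - sq_length (?s q) e\<bar> < \<delta>) \<longrightarrow>
        (\<exists>a. N q \<epsilon> a \<and> (\<forall>e\<in>E'. sq_length a e = b e))"
      unfolding N_def by (rule realise_nearby_lengths[OF G' _ \<open>\<epsilon> > 0\<close>])
  next
    fix q \<delta> \<delta>' assume "\<forall>b. (\<forall>e\<in>E'. \<bar>b e - sq_length (?s q) e\<bar> < \<delta>) \<longrightarrow>
        (\<exists>a. N q \<epsilon> a \<and> (\<forall>e\<in>E'. sq_length a e = b e))" and "\<delta>' \<le> (\<delta> :: real)"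
    then show "\<forall>b. (\<forall>e\<in>E'. \<bar>b e - sq_length (?s q) e\<bar> < \<delta>') \<longrightarrow>
        (\<exists>a. N q \<epsilon> a \<and> (\<forall>e\<in>E'. sq_length a e = b e))"
      by (meson order_less_le_trans)
  qed
  then obtain \<delta> where "\<delta> > 0" and realise: "\<And>q b. q \<in> Q \<Longrightarrow>
      \<forall>e\<in>E'. \<bar>b e - sq_length (?s q) e\<bar> < \<delta> \<Longrightarrow> \<exists>a. N q \<epsilon> a \<and> (\<forall>e\<in>E'. sq_length a e = b e)"
    by blast
  have "\<exists>\<eta>>0. \<forall>e\<in>E'. \<forall>a. (\<forall>v\<in>V'. dist (a v) (?s p v) < \<eta>) \<longrightarrow> \<bar>sq_length a e - sq_length (?s p) e\<bar> < \<delta>"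
  proof (rule finite_uniform_positive[OF fin'(2)])
    fix e assume "e \<in> E'"
    then obtain u v where "u \<in> V'" "v \<in> V'" "e = {u, v}" using simple_graph_edge[OF G'] by blast
    then show "\<exists>\<eta>>0. \<forall>a. (\<forall>v\<in>V'. dist (a v) (?s p v) < \<eta>) \<longrightarrow> \<bar>sq_length a e - sq_length (?s p) e\<bar> < \<delta>"
      using sq_length_continuous[OF \<open>\<delta> > 0\<close>, of u "?s p" v] by blast
  next
    fix e \<eta> \<eta>' assume "\<forall>a. (\<forall>v\<in>V'. dist (a v) (?s p v) < \<eta>) \<longrightarrow> \<bar>sq_length a e - sq_length (?s p) e\<bar> < \<delta>"
      and "\<eta>' \<le> (\<eta> :: real)"
    then show "\<forall>a. (\<forall>v\<in>V'. dist (a v) (?s p v) < \<eta>') \<longrightarrow> \<bar>sq_length a e - sq_length (?s p) e\<bar> < \<delta>"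
      by (meson order_less_le_trans)
  qed
  then obtain \<eta> where "\<eta> > 0" and close: "\<And>e a. e \<in> E' \<Longrightarrow> \<forall>v\<in>V'. dist (a v) (?s p v) < \<eta> \<Longrightarrow>
      \<bar>sq_length a e - sq_length (?s p) e\<bar> < \<delta>"
    by blast
  obtain p' where p': "p' \<in> V' \<rightarrow>\<^sub>E UNIV" "generic V' p'" "\<forall>v\<in>V'. dist (p' v) (?s p v) < \<eta>"
    using generic_dense[OF fin'(1) \<open>\<eta> > 0\<close>] by blast
  have "\<forall>q\<in>Q. \<exists>a. N q \<epsilon> a \<and> (\<forall>e\<in>E'. sq_length a e = sq_length p' e)"
  proof
    fix q assume q: "q \<in> Q"
    show "\<exists>a. N q \<epsilon> a \<and> (\<forall>e\<in>E'. sq_length a e = sq_length p' e)"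
    proof (rule realise[OF q], rule ballI)
      fix e assume e: "e \<in> E'"
      show "\<bar>sq_length p' e - sq_length (?s q) e\<bar> < \<delta>"
        using close[OF e p'(3)] split_framework_equivalent[OF G S Q(3)[OF q] e] by simp
    qed
  qed
  then obtain a where a: "\<And>q. q \<in> Q \<Longrightarrow> N q \<epsilon> (a q)"
      "\<And>q e. q \<in> Q \<Longrightarrow> e \<in> E' \<Longrightarrow> sq_length (a q) e = sq_length p' e" by metis
  \<comment> \<open>\<open>num_classes\<close> counts extensional realisations only.\<close>
  define a' where "a' q = restrict (a q) V'" for q
  have N: "N q \<epsilon> (a' q)" if "q \<in> Q" for q
    using a(1)[OF that] by (simp add: N_def a'_def)
  have ncong: "\<not> congruent_real V' (a' q) (a' q')" if "q \<in> Q" "q' \<in> Q" "q \<noteq> q'" for q q'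
    using incong[OF that] N that by blast
  then have inj: "inj_on a' Q"
    by (intro inj_onI) (metis congruent_real_refl)
  have "enat (card (a' ` Q)) \<le> num_classes V' E' p'"
  proof (rule num_classes_ge)
    show "a' ` Q \<subseteq> V' \<rightarrow>\<^sub>E UNIV" by (auto simp: a'_def)
    fix b assume "b \<in> a' ` Q"
    then obtain q where q: "q \<in> Q" "b = a' q" by blast
    have "sq_length p' e = sq_length b e" if e: "e \<in> E'" for e
    proof -
      have "sq_length b e = sq_length (a q) e"
        by (rule edge_form_cong[OF G' e]) (auto simp: q a'_def)
      then show ?thesis using a(2)[OF q(1) e] by simp
    qed
    then show "equivalent_real E' p' b" using equivalent_real_iff_sq_length[OF G'] by blast
  qed (use Q(1) ncong in auto)
  also have "\<dots> \<le> r_d TYPE('n) V' E'"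
    unfolding r_d_def by (rule SUP_upper) (use p' in auto)
  finally show ?thesis using card_image[OF inj] Q(2) by simp
qed

theorem theorem4p14:
  fixes V V' :: "'a set" and E E' :: "'a set set"
    and x x1 x2 :: 'a and N1 N2 W :: "'a set"
  assumes "simple_graph V E"
    and "min_d_rigid TYPE('n::finite) V E"
    and "card V \<ge> CARD('n) + 1"
    and "spider_split CARD('n) V E x N1 N2 W x1 x2 V' E'"
  shows "r_d TYPE('n) V' E' \<ge> r_d TYPE('n) V E"
proof -
  have "num_classes V E p \<le> r_d TYPE('n) V' E'" if "generic V p" for p :: "'a \<Rightarrow> real^'n"
  proof (cases "r_d TYPE('n) V' E'")
    case (enat k)
    \<comment> \<open>Excluding \<open>Suc k\<close> classes excludes every larger number and
      infinity at once.\<close>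
    have "\<not> enat (Suc k) \<le> num_classes V E p"
      using spider_split_num_classes[OF assms(1,2,4) that, of "Suc k"] enat by auto
    then show ?thesis using enat by (cases "num_classes V E p") auto
  qed simp
  then show ?thesis unfolding r_d_def[of _ V E] by (intro SUP_least) auto
qed

end
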